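(* Let $\mathbf{G}$ be a complete spray on an $n$-dimensional manifold $M$. Suppose that $\mathbf{G}$ is projectively Ricci-flat. If the Ricci curvature satisfies $\mathbf{Ric}_{\mathbf{G}}\geq 0$, then for any volume form $dV$ on $M$ there is a scalar function $\phi$ on $M$ such that the S-curvature $\mathbf{S}=\mathbf{S}_{(\mathbf{G},dV)}$ satisfies $\mathbf{S}=(n+1)\phi_0$, where $\phi_0=\phi_{x^m}y^m$. In this case, $\mathbf{Ric}_{\mathbf{G}}=0$.
   Context: Let $M$ be an $n$-dimensional smooth manifold, $(x^i)$ local coordinates on $M$ and $(x^i,y^i)$ the induced coordinates on $TM$; repeated indices are summed. A spray $\mathbf{G}$ on $M$ is a smooth vector field on the slit tangent bundle $TM_0=TM\setminus\{0\}$ which in every standard local coordinate system has the form $\mathbf{G}=y^i\frac{\partial}{\partial x^i}-2G^i(x,y)\frac{\partial}{\partial y^i}$ with $G^i(x,\lambda y)=\lambda^2G^i(x,y)$ for all $\lambda>0$. Geodesics of $\mathbf{G}$ are the projections to $M$ of integral curves of $\mathbf{G}$; $\mathbf{G}$ is complete if every geodesic is defined (extends) on all of $(-\infty,\infty)$. The Riemann curvature of $\mathbf{G}$ is $$R^i_{\ k}=2\frac{\partial G^i}{\partial x^k}-y^j\frac{\partial^2G^i}{\partial x^j\partial y^k}+2G^j\frac{\partial^2G^i}{\partial y^j\partial y^k}-\frac{\partial G^i}{\partial y^s}\frac{\partial G^s}{\partial y^k},$$ and its Ricci curvature is $\mathbf{Ric}_{\mathbf{G}}:=R^m_{\ m}$,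 a function on $TM_0$. A volume form on $M$ is written locally as $dV=\sigma(x)\,dx^1\cdots dx^n$ with $\sigma>0$ smooth. The S-curvature of $(\mathbf{G},dV)$ is the function on $TM_0$ given by $\mathbf{S}_{(\mathbf{G},dV)}:=\frac{\partial G^m}{\partial y^m}-y^m\frac{\partial}{\partial x^m}(\ln\sigma)$. The projective spray of $(\mathbf{G},dV)$ is $\hat{\mathbf{G}}:=\mathbf{G}+\frac{2\mathbf{S}}{n+1}\mathbf{Y}$ with $\mathbf{Y}=y^i\frac{\partial}{\partial y^i}$, i.e. $\hat G^i=G^i-\frac{\mathbf{S}}{n+1}y^i$. The projective Ricci curvature is $\mathbf{PRic}_{(\mathbf{G},dV)}:=\mathbf{Ric}_{\hat{\mathbf{G}}}$. The spray $\mathbf{G}$ is called projectively Ricci-flat if there is a volume form $dV$ on $M$ such that $\mathbf{PRic}_{(\mathbf{G},dV)}=0$. Scalar functions on $M$ are smooth functions of $x$ only.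
   Formalization: The dimension is assumed to satisfy n ≥ 2; for n = 1 the claim fails, e.g. on M = ℝ with G = c(x)y² for y > 0 and G = 0 for y < 0, c a nonzero nonnegative bump function, where S is not linear in y. *)

theory Defs
  imports "HOL-Analysis.Analysis"
begin

section \<open>Smooth maps between open subsets of Euclidean spaces\<close>

text \<open>Class \<open>C\<^sup>k\<close> on an open set: the directional derivatives of order at most \<open>k\<close>, in all
  directions, exist (as values of Frechet derivatives) and are continuous.\<close>

primrec Ck_on :: "nat \<Rightarrow> 'a::euclidean_space set \<Rightarrow> ('a \<Rightarrow> 'b::euclidean_space) \<Rightarrow> bool" where
  "Ck_on 0 S f \<longleftrightarrow> continuous_on S f"
| "Ck_on (Suc k) S f \<longleftrightarrow> (\<forall>x\<in>S. f differentiable (at x)) \<and>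
      (\<forall>v. Ck_on k S (\<lambda>x. frechet_derivative f (at x) v))"

definition smooth_on :: "'a::euclidean_space set \<Rightarrow> ('a \<Rightarrow> 'b::euclidean_space) \<Rightarrow> bool" where
  "smooth_on S f \<longleftrightarrow> (\<forall>k. Ck_on k S f)"

section \<open>Charts and smooth structures\<close>

text \<open>The values of the coordinate map outside the domain of a chart are irrelevant.\<close>

datatype ('p, 'e) chart = Chart (chart_dom: "'p set") (chart_map: "'p \<Rightarrow> 'e")

abbreviation chart_img :: "('p, 'e) chart \<Rightarrow> 'e set" where
  "chart_img c \<equiv> chart_map c ` chart_dom c"

definition chart_inv :: "('p, 'e) chart \<Rightarrow> 'e \<Rightarrow> 'p" where
  "chart_inv c = inv_into (chart_dom c) (chart_map c)"

definition transition :: "('p, 'e) chart \<Rightarrow> ('p, 'e) chart \<Rightarrow> 'e \<Rightarrow> 'e" where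
  "transition c d = chart_map d \<circ> chart_inv c"

definition topological_chart ::
    "('m::topological_space, 'e::euclidean_space) chart \<Rightarrow> bool" where
  "topological_chart c \<longleftrightarrow> open (chart_dom c) \<and> open (chart_img c) \<and>
     homeomorphism (chart_dom c) (chart_img c) (chart_map c) (chart_inv c)"

definition smoothly_compatible ::
    "('m, 'e::euclidean_space) chart \<Rightarrow> ('m, 'e) chart \<Rightarrow> bool" where
  "smoothly_compatible c d \<longleftrightarrow>
     smooth_on (chart_map c ` (chart_dom c \<inter> chart_dom d)) (transition c d) \<and>
     smooth_on (chart_map d ` (chart_dom c \<inter> chart_dom d)) (transition d c)"

text \<open>A smooth structure is a maximal smooth atlas, so its elements are exactly the local
  coordinate systems of the manifold.  The Hausdorff property and second countability are put
  into the type of points.\<close>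

definition smooth_structure ::
    "('m::{t2_space,second_countable_topology}, 'e::euclidean_space) chart set \<Rightarrow> bool" where
  "smooth_structure A \<longleftrightarrow>
     (\<forall>c\<in>A. topological_chart c) \<and>
     (\<Union>c\<in>A. chart_dom c) = UNIV \<and>
     (\<forall>c\<in>A. \<forall>d\<in>A. smoothly_compatible c d) \<and>
     (\<forall>c. topological_chart c \<and> (\<forall>d\<in>A. smoothly_compatible c d) \<longrightarrow> c \<in> A)"

section \<open>Tangent vectors, vector fields, integral curves\<close>

text \<open>A tangent vector at \<open>p\<close> is the family of its component vectors in all charts around \<open>p\<close>,
  two of which are related by the Jacobian of the change of coordinates.  The value at charts not
  around \<open>p\<close> is fixed to be \<open>0\<close>, so that distinct families are distinct tangent vectors.
  These notions do not refer to a topology on the points; they are used below both for the manifold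
  and for its slit tangent bundle with the atlas of induced charts.\<close>

type_synonym ('p, 'e) components = "('p, 'e) chart \<Rightarrow> 'e"

definition tangent_at ::
    "('p, 'e::euclidean_space) chart set \<Rightarrow> 'p \<Rightarrow> ('p, 'e) components \<Rightarrow> bool" where
  "tangent_at A p v \<longleftrightarrow>
     (\<forall>c. \<not> (c \<in> A \<and> p \<in> chart_dom c) \<longrightarrow> v c = 0) \<and>
     (\<forall>c\<in>A. \<forall>d\<in>A. p \<in> chart_dom c \<inter> chart_dom d \<longrightarrow>
        v d = frechet_derivative (transition c d) (at (chart_map c p)) (v c))"

type_synonym ('p, 'e) vector_field = "'p \<Rightarrow> ('p, 'e) components"

definition smooth_vector_field ::
    "('p, 'e::euclidean_space) chart set \<Rightarrow> ('p, 'e) vector_field \<Rightarrow> bool" where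
  "smooth_vector_field A X \<longleftrightarrow>
     (\<forall>p \<in> (\<Union>c\<in>A. chart_dom c). tangent_at A p (X p)) \<and>
     (\<forall>c\<in>A. smooth_on (chart_img c) (\<lambda>z. X (chart_inv c z) c))"

text \<open>Requiring \<open>\<gamma>\<close> to stay in \<open>chart_dom c\<close> near \<open>t\<close> amounts to continuity of \<open>\<gamma>\<close> and
  keeps the values of \<open>chart_map c\<close> outside the domain from entering the derivative.\<close>

definition integral_curve ::
    "('p, 'e::euclidean_space) chart set \<Rightarrow> ('p, 'e) vector_field \<Rightarrow> real set \<Rightarrow> (real \<Rightarrow> 'p) \<Rightarrow> bool"
  where
  "integral_curve A X I \<gamma> \<longleftrightarrow>
     (\<forall>t\<in>I. \<gamma> t \<in> (\<Union>c\<in>A. chart_dom c) \<and>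
        (\<forall>c\<in>A. \<gamma> t \<in> chart_dom c \<longrightarrow>
           (\<forall>\<^sub>F s in at t. \<gamma> s \<in> chart_dom c) \<and>
           ((chart_map c \<circ> \<gamma>) has_vector_derivative X (\<gamma> t) c) (at t)))"

section \<open>The slit tangent bundle\<close>

type_synonym ('m, 'e) tvec = "'m \<times> ('m, 'e) components"

definition slit_tangent_bundle ::
    "('m, 'e::euclidean_space) chart set \<Rightarrow> ('m, 'e) tvec set" where
  "slit_tangent_bundle A = {(p, v). tangent_at A p v \<and> v \<noteq> (\<lambda>_. 0)}"

text \<open>The induced coordinates \<open>(x\<^sup>i, y\<^sup>i)\<close> on the slit tangent bundle.\<close>

definition induced_chart ::
    "('m, 'e::euclidean_space) chart set \<Rightarrow> ('m, 'e) chart \<Rightarrow> (('m, 'e) tvec, 'e \<times> 'e) chart" where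
  "induced_chart A c =
     Chart {(p, v) \<in> slit_tangent_bundle A. p \<in> chart_dom c} (\<lambda>(p, v). (chart_map c p, v c))"

definition slit_atlas ::
    "('m, 'e::euclidean_space) chart set \<Rightarrow> (('m, 'e) tvec, 'e \<times> 'e) chart set" where
  "slit_atlas A = induced_chart A ` A"

section \<open>Sprays\<close>

type_synonym ('m, 'e) slit_field = "(('m, 'e) tvec, 'e \<times> 'e) vector_field"

text \<open>The functions \<open>G\<^sup>i(x,y)\<close> of a spray \<open>y\<^sup>i \<partial>/\<partial>x\<^sup>i - 2 G\<^sup>i \<partial>/\<partial>y\<^sup>i\<close> in a chart.\<close>

definition spray_coeff ::
    "('m, 'e::euclidean_space) chart set \<Rightarrow> ('m, 'e) slit_field \<Rightarrow> ('m, 'e) chart \<Rightarrow> 'e \<times> 'e \<Rightarrow> 'e" where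
  "spray_coeff A G c z =
     - (1/2) *\<^sub>R snd (G (chart_inv (induced_chart A c) z) (induced_chart A c))"

definition spray :: "('m, 'e::euclidean_space) chart set \<Rightarrow> ('m, 'e) slit_field \<Rightarrow> bool" where
  "spray A G \<longleftrightarrow> smooth_vector_field (slit_atlas A) G \<and>
     (\<forall>c\<in>A. \<forall>x\<in>chart_img c. \<forall>y. y \<noteq> 0 \<longrightarrow>
        G (chart_inv (induced_chart A c) (x, y)) (induced_chart A c)
          = (y, - 2 *\<^sub>R spray_coeff A G c (x, y)) \<and>
        (\<forall>r>0. spray_coeff A G c (x, r *\<^sub>R y) = r\<^sup>2 *\<^sub>R spray_coeff A G c (x, y)))"

definition geodesic ::
    "('m, 'e::euclidean_space) chart set \<Rightarrow> ('m, 'e) slit_field \<Rightarrow> real set \<Rightarrow> (real \<Rightarrow> 'm) \<Rightarrow> bool" where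
  "geodesic A G I \<gamma> \<longleftrightarrow>
     (\<exists>u. integral_curve (slit_atlas A) G I u \<and> (\<forall>t\<in>I. \<gamma> t = fst (u t)))"

definition complete_spray ::
    "('m, 'e::euclidean_space) chart set \<Rightarrow> ('m, 'e) slit_field \<Rightarrow> bool" where
  "complete_spray A G \<longleftrightarrow>
     (\<forall>I \<gamma>. open I \<and> is_interval I \<and> I \<noteq> {} \<and> geodesic A G I \<gamma> \<longrightarrow>
        (\<exists>\<delta>. geodesic A G UNIV \<delta> \<and> (\<forall>t\<in>I. \<delta> t = \<gamma> t)))"

section \<open>Curvatures in local coordinates\<close>

definition pd :: "'n::finite \<Rightarrow> (real^'n \<Rightarrow> real) \<Rightarrow> real^'n \<Rightarrow> real" where
  "pd k f x = frechet_derivative f (at x) (axis k 1)"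

definition pdx :: "'n::finite \<Rightarrow> ((real^'n) \<times> (real^'n) \<Rightarrow> real) \<Rightarrow> (real^'n) \<times> (real^'n) \<Rightarrow> real" where
  "pdx k f z = frechet_derivative f (at z) (axis k 1, 0)"

definition pdy :: "'n::finite \<Rightarrow> ((real^'n) \<times> (real^'n) \<Rightarrow> real) \<Rightarrow> (real^'n) \<times> (real^'n) \<Rightarrow> real" where
  "pdy k f z = frechet_derivative f (at z) (0, axis k 1)"

definition riemann_coord ::
    "((real^'n) \<times> (real^'n) \<Rightarrow> real^'n) \<Rightarrow> 'n \<Rightarrow> 'n \<Rightarrow> (real^'n) \<times> (real^'n) \<Rightarrow> real" where
  "riemann_coord H i k z =
     2 * pdx k (\<lambda>u. H u $ i) z
     - (\<Sum>j\<in>UNIV. snd z $ j * pdx j (pdy k (\<lambda>u. H u $ i)) z)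
     + 2 * (\<Sum>j\<in>UNIV. H z $ j * pdy j (pdy k (\<lambda>u. H u $ i)) z)
     - (\<Sum>s\<in>UNIV. pdy s (\<lambda>u. H u $ i) z * pdy k (\<lambda>u. H u $ s) z)"

definition ricci_coord ::
    "((real^'n) \<times> (real^'n) \<Rightarrow> real^'n) \<Rightarrow> (real^'n) \<times> (real^'n) \<Rightarrow> real" where
  "ricci_coord H z = (\<Sum>m\<in>UNIV. riemann_coord H m m z)"

section \<open>Curvatures as functions on the slit tangent bundle\<close>

text \<open>The local formulas for the Ricci curvature, the S-curvature and \<open>\<phi>\<^sub>0\<close> do not depend on the
  chart; the corresponding functions are evaluated in some chart around the base point.\<close>

definition chart_at :: "('m, 'e) chart set \<Rightarrow> 'm \<Rightarrow> ('m, 'e) chart" where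
  "chart_at A p = (SOME c. c \<in> A \<and> p \<in> chart_dom c)"

definition ricci ::
    "('m, real^'n) chart set \<Rightarrow> ('m, real^'n) slit_field \<Rightarrow> ('m, real^'n) tvec \<Rightarrow> real" where
  "ricci A G w = (let c = chart_at A (fst w)
     in ricci_coord (spray_coeff A G c) (chart_map (induced_chart A c) w))"

text \<open>A volume form \<open>\<sigma> dx\<^sup>1\<dots>dx\<^sup>n\<close> is given by its positive coefficient \<open>\<sigma>\<close> in every chart, a
  function of the coordinates, which transforms by the absolute value of the Jacobian determinant;
  in particular \<open>M\<close> need not be orientable.\<close>

type_synonym ('m, 'n) density = "('m, real^'n) chart \<Rightarrow> real^'n \<Rightarrow> real"

definition volume_form :: "('m, real^'n) chart set \<Rightarrow> ('m, 'n::finite) density \<Rightarrow> bool" where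
  "volume_form A \<sigma> \<longleftrightarrow>
     (\<forall>c\<in>A. smooth_on (chart_img c) (\<sigma> c) \<and> (\<forall>x\<in>chart_img c. \<sigma> c x > 0)) \<and>
     (\<forall>c\<in>A. \<forall>d\<in>A. \<forall>x \<in> chart_map c ` (chart_dom c \<inter> chart_dom d).
        \<sigma> c x = \<sigma> d (transition c d x) *
          \<bar>det (matrix (frechet_derivative (transition c d) (at x)))\<bar>)"

definition S_curvature ::
    "('m, real^'n) chart set \<Rightarrow> ('m, real^'n) slit_field \<Rightarrow> ('m, 'n::finite) density \<Rightarrow>
     ('m, real^'n) tvec \<Rightarrow> real" where
  "S_curvature A G \<sigma> w = (let c = chart_at A (fst w); z = chart_map (induced_chart A c) w in
     (\<Sum>m\<in>UNIV. pdy m (\<lambda>u. spray_coeff A G c u $ m) z)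
     - (\<Sum>m\<in>UNIV. snd z $ m * pd m (\<lambda>x. ln (\<sigma> c x)) (fst z)))"

text \<open>The vertical field \<open>Y = y\<^sup>i \<partial>/\<partial>y\<^sup>i\<close>.\<close>

definition liouville_field ::
    "('m, 'e::euclidean_space) chart set \<Rightarrow> ('m, 'e) slit_field" where
  "liouville_field A w C =
     (if C \<in> slit_atlas A \<and> w \<in> chart_dom C then (0, snd (chart_map C w)) else 0)"

definition projective_spray ::
    "('m, real^'n) chart set \<Rightarrow> ('m, real^'n) slit_field \<Rightarrow> ('m, 'n::finite) density \<Rightarrow>
     ('m, real^'n) slit_field" where
  "projective_spray A G \<sigma> w C =
     G w C + (2 * S_curvature A G \<sigma> w / (real CARD('n) + 1)) *\<^sub>R liouville_field A w C"

definition projective_ricci ::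
    "('m, real^'n) chart set \<Rightarrow> ('m, real^'n) slit_field \<Rightarrow> ('m, 'n::finite) density \<Rightarrow>
     ('m, real^'n) tvec \<Rightarrow> real" where
  "projective_ricci A G \<sigma> = ricci A (projective_spray A G \<sigma>)"

definition projectively_ricci_flat ::
    "('m, real^'n::finite) chart set \<Rightarrow> ('m, real^'n) slit_field \<Rightarrow> bool" where
  "projectively_ricci_flat A G \<longleftrightarrow>
     (\<exists>\<sigma>. volume_form A \<sigma> \<and> (\<forall>w\<in>slit_tangent_bundle A. projective_ricci A G \<sigma> w = 0))"

definition scalar_function ::
    "('m, 'e::euclidean_space) chart set \<Rightarrow> ('m \<Rightarrow> real) \<Rightarrow> bool" where
  "scalar_function A \<phi> \<longleftrightarrow> (\<forall>c\<in>A. smooth_on (chart_img c) (\<phi> \<circ> chart_inv c))"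

text \<open>\<open>\<phi>\<^sub>0 = \<phi>\<^bsub>x\<^sup>m\<^esub> y\<^sup>m\<close>\<close>

definition differential_along ::
    "('m, real^'n::finite) chart set \<Rightarrow> ('m \<Rightarrow> real) \<Rightarrow> ('m, real^'n) tvec \<Rightarrow> real" where
  "differential_along A \<phi> w = (let c = chart_at A (fst w); z = chart_map (induced_chart A c) w in
     (\<Sum>m\<in>UNIV. pd m (\<phi> \<circ> chart_inv c) (fst z) * snd z $ m))"

end

theory Submission
  imports Defs
begin

text \<open>Let \<open>\<sigma>\<close> be a volume form with vanishing projective Ricci curvature, and put
  \<open>P = S / (n + 1)\<close>, where \<open>S\<close> is the S-curvature of \<open>G\<close> with respect to \<open>\<sigma>\<close>.
  The projective spray has the coefficients \<open>G\<^sup>i - P y\<^sup>i\<close>, and Euler's theorem for homogeneous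
  functions turns the coordinate formula of its Ricci curvature into
  \<open>Ric\<^sub>G + (n - 1) (G(P) + P\<^sup>2)\<close>, with \<open>G(P)\<close> the derivative of \<open>P\<close> along the vector
  field \<open>G\<close> (\<open>ricci_coord_projective_change\<close>).  As this vanishes, \<open>Ric\<^sub>G \<ge> 0\<close> and
  \<open>n \<ge> 2\<close> give \<open>G(P) + P\<^sup>2 \<le> 0\<close>.

  Along an integral curve of \<open>G\<close>, which by completeness is defined for all times, \<open>P\<close> therefore
  satisfies \<open>P' \<le> - P\<^sup>2\<close> on the whole line.  Such a function is zero: wherever it is negative it
  tends to minus infinity in finite future time, and positive values are excluded by reversing time
  (\<open>riccati_global_solution_zero\<close>).  Every point of the slit tangent bundle lies on an integral
  curve, so \<open>P = 0\<close> and hence \<open>Ric\<^sub>G = 0\<close>.  Replacing \<open>\<sigma>\<close> by another volume form \<open>\<mu>\<close>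
  changes the S-curvature by the differential of \<open>ln (\<sigma> / \<mu>)\<close>, which is a function on the
  manifold because the Jacobians cancel.

  The argument needs three general facts.  The S-curvature has to be independent of the chart; this
  is Jacobi's formula for the derivative of a determinant combined with the symmetry of second
  derivatives (\<open>S_coord_change\<close>).  Integral curves have to exist locally, which is the
  Picard-Lindelof theorem (\<open>local_solution_exists\<close>).  Finally, completeness extends the geodesic
  and not its lift, so that the lift has to be recovered from the geodesic as its velocity
  (\<open>integral_curve_exists\<close>).\<close>

section \<open>Functions of class \<open>C\<^sup>k\<close>\<close>

lemma frechet_derivative_eqI:
  "(f has_derivative f') (at x) \<Longrightarrow> frechet_derivative f (at x) = f'"
  by (rule frechet_derivative_at[symmetric])

text \<open>This holds for arbitrary functions, because \<open>frechet_derivative\<close> is a choice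
  among the linear maps that are a derivative, and both functions have the same ones.\<close>

lemma frechet_derivative_cong_open:
  assumes "open S" "x \<in> S" "\<And>u. u \<in> S \<Longrightarrow> f u = g u"
  shows "frechet_derivative f (at x) = frechet_derivative g (at x)"
proof -
  have "(f has_derivative D) (at x) \<longleftrightarrow> (g has_derivative D) (at x)" for D
    using has_derivative_transform_within_open[of f D x UNIV S g]
      has_derivative_transform_within_open[of g D x UNIV S f] assms by auto
  then show ?thesis by (simp add: frechet_derivative_def)
qed

lemma Ck_on_cong:
  assumes "open S" "\<And>x. x \<in> S \<Longrightarrow> f x = g x" "Ck_on k S f"
  shows "Ck_on k S g"
  using assms(2,3)
proof (induction k arbitrary: f g)
  case 0
  then show ?case by (auto cong: continuous_on_cong)
next
  case (Suc k)
  have diff: "g differentiable (at x)" if "x \<in> S" for x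
  proof -
    obtain f' where "(f has_derivative f') (at x)"
      using Suc.prems(2) \<open>x \<in> S\<close> by (auto simp: differentiable_def)
    then have "(g has_derivative f') (at x)"
      by (rule has_derivative_transform_within_open[OF _ assms(1) \<open>x \<in> S\<close> Suc.prems(1)])
    then show ?thesis by (auto simp: differentiable_def)
  qed
  moreover have "Ck_on k S (\<lambda>x. frechet_derivative g (at x) v)" for v
  proof (rule Suc.IH)
    show "Ck_on k S (\<lambda>x. frechet_derivative f (at x) v)" using Suc.prems by simp
    show "frechet_derivative f (at x) v = frechet_derivative g (at x) v" if "x \<in> S" for x
      using frechet_derivative_transform_within_open[of f x S g] Suc.prems that assms(1) by auto
  qed
  ultimately show ?case by simp
qed

lemma Ck_on_Suc_imp: "Ck_on (Suc k) S f \<Longrightarrow> Ck_on k S f"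
proof (induction k arbitrary: f)
  case 0
  then show ?case
    by (auto intro!: continuous_at_imp_continuous_on differentiable_imp_continuous_within)
next
  case (Suc k)
  have "(\<forall>x\<in>S. f differentiable (at x)) \<and> (\<forall>v. Ck_on (Suc k) S (\<lambda>x. frechet_derivative f (at x) v))"
    using Suc.prems by (subst (asm) Ck_on.simps(2))
  then show ?case using Suc.IH by (subst Ck_on.simps(2)) blast
qed

lemma Ck_on_le: "Ck_on m S f \<Longrightarrow> k \<le> m \<Longrightarrow> Ck_on k S f"
proof (induction m)
  case 0
  then show ?case by simp
next
  case (Suc m)
  show ?case
  proof (cases "k = Suc m")
    case True
    then show ?thesis using Suc.prems by blast
  next
    case False
    then show ?thesis using Suc.IH[OF Ck_on_Suc_imp[OF Suc.prems(1)]] Suc.prems(2) by linarith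
  qed
qed

text \<open>The induction step in every closure property: it is enough to exhibit the derivative and
  to see that it is of class \<open>C\<^sup>k\<close> in each direction.\<close>

lemma Ck_on_SucI:
  assumes "open S" "\<And>x. x \<in> S \<Longrightarrow> (f has_derivative f' x) (at x)"
    "\<And>v. Ck_on k S (\<lambda>x. f' x v)"
  shows "Ck_on (Suc k) S f"
proof -
  have "frechet_derivative f (at x) = f' x" if "x \<in> S" for x
    by (rule frechet_derivative_eqI[OF assms(2)[OF that]])
  then have "Ck_on k S (\<lambda>x. frechet_derivative f (at x) v)" for v
    by (intro Ck_on_cong[OF assms(1) _ assms(3)[of v]]) simp
  then show ?thesis using assms(2) by (auto simp: differentiable_def)
qed

lemma Ck_on_has_derivative:
  assumes "Ck_on (Suc k) S f" "x \<in> S"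
  shows "(f has_derivative frechet_derivative f (at x)) (at x)"
  using assms by (simp add: frechet_derivative_works)

lemma Ck_on_SucD: "Ck_on (Suc k) S f \<Longrightarrow> Ck_on k S (\<lambda>x. frechet_derivative f (at x) v)"
  by simp

lemma Ck_on_differentiable: "Ck_on k S f \<Longrightarrow> 1 \<le> k \<Longrightarrow> x \<in> S \<Longrightarrow> f differentiable (at x)"
  by (cases k) auto

lemma Ck_on_const: "Ck_on k S (\<lambda>x. c)"
  by (induction k arbitrary: c) (auto simp: frechet_derivative_const)

lemma Ck_on_bounded_linear:
  assumes "bounded_linear L" shows "Ck_on k S L"
proof (cases k)
  case 0
  then show ?thesis using assms by (simp add: linear_continuous_on)
next
  case (Suc m)
  have "frechet_derivative L (at x) = L" for x
    by (rule frechet_derivative_eqI[OF bounded_linear_imp_has_derivative[OF assms]])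
  then show ?thesis using Suc assms
    by (simp add: Ck_on_const bounded_linear_imp_differentiable)
qed

lemma Ck_on_compose_linear:
  assumes "open S" "bounded_linear L" "Ck_on k S f"
  shows "Ck_on k S (\<lambda>x. L (f x))"
  using assms(3)
proof (induction k arbitrary: f)
  case 0
  then show ?case using linear_continuous_on_compose assms(2)
    by (simp add: bounded_linear.continuous_on)
next
  case (Suc k)
  show ?case
  proof (rule Ck_on_SucI[OF assms(1)])
    show "((\<lambda>x. L (f x)) has_derivative (\<lambda>v. L (frechet_derivative f (at x) v))) (at x)" if "x \<in> S" for x
      by (rule bounded_linear.has_derivative[OF assms(2) Ck_on_has_derivative[OF Suc.prems that]])
    show "Ck_on k S (\<lambda>x. L (frechet_derivative f (at x) v))" for v
      by (rule Suc.IH[OF Ck_on_SucD[OF Suc.prems]])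
  qed
qed

lemma Ck_on_precompose_linear:
  assumes "open S" "open T" "bounded_linear L" "L ` T \<subseteq> S" "Ck_on k S f"
  shows "Ck_on k T (\<lambda>x. f (L x))"
  using assms(5)
proof (induction k arbitrary: f)
  case 0
  then have "continuous_on S f" by simp
  then show ?case using assms
    by (simp add: continuous_on_compose2[OF _ linear_continuous_on])
next
  case (Suc k)
  show ?case
  proof (rule Ck_on_SucI[OF assms(2)])
    fix x assume "x \<in> T"
    then have "(f has_derivative frechet_derivative f (at (L x))) (at (L x))"
      using Ck_on_has_derivative[OF Suc.prems] assms(4) by blast
    with bounded_linear_imp_has_derivative[OF assms(3)]
    show "((\<lambda>x. f (L x)) has_derivative (\<lambda>v. frechet_derivative f (at (L x)) (L v))) (at x)"
      by (rule has_derivative_compose)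
  next
    fix v show "Ck_on k T (\<lambda>x. frechet_derivative f (at (L x)) (L v))"
      by (rule Suc.IH[OF Ck_on_SucD[OF Suc.prems]])
  qed
qed

lemma Ck_on_add:
  assumes "open S" "Ck_on k S f" "Ck_on k S g"
  shows "Ck_on k S (\<lambda>x. f x + g x)"
  using assms(2,3)
proof (induction k arbitrary: f g)
  case 0
  then show ?case by (simp add: continuous_on_add)
next
  case (Suc k)
  show ?case
  proof (rule Ck_on_SucI[OF assms(1)])
    show "((\<lambda>x. f x + g x) has_derivative
        (\<lambda>v. frechet_derivative f (at x) v + frechet_derivative g (at x) v)) (at x)" if "x \<in> S" for x
      using that Suc.prems by (intro has_derivative_add Ck_on_has_derivative)
    show "Ck_on k S (\<lambda>x. frechet_derivative f (at x) v + frechet_derivative g (at x) v)" for v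
      by (intro Suc.IH Ck_on_SucD Suc.prems)
  qed
qed

lemma Ck_on_mult:
  fixes f g :: "'a::euclidean_space \<Rightarrow> real"
  assumes "open S" "Ck_on k S f" "Ck_on k S g"
  shows "Ck_on k S (\<lambda>x. f x * g x)"
  using assms(2,3)
proof (induction k arbitrary: f g)
  case 0
  then show ?case by (simp add: continuous_on_mult)
next
  case (Suc k)
  show ?case
  proof (rule Ck_on_SucI[OF assms(1)])
    show "((\<lambda>x. f x * g x) has_derivative
        (\<lambda>v. f x * frechet_derivative g (at x) v + frechet_derivative f (at x) v * g x)) (at x)" if "x \<in> S" for x
      using that Suc.prems by (intro has_derivative_mult Ck_on_has_derivative)
    show "Ck_on k S (\<lambda>x. f x * frechet_derivative g (at x) v + frechet_derivative f (at x) v * g x)" for v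
      by (intro Ck_on_add[OF assms(1)] Suc.IH Ck_on_SucD Suc.prems Suc.prems[THEN Ck_on_Suc_imp])
  qed
qed

lemma Ck_on_sum:
  assumes "open S" "finite I" "\<And>i. i \<in> I \<Longrightarrow> Ck_on k S (f i)"
  shows "Ck_on k S (\<lambda>x. \<Sum>i\<in>I. f i x)"
  using assms(2,3)
  by (induction I rule: finite_induct) (auto intro: Ck_on_const Ck_on_add[OF assms(1)])

lemma Ck_on_cmult:
  fixes f :: "'a::euclidean_space \<Rightarrow> real"
  assumes "open S" "Ck_on k S f" shows "Ck_on k S (\<lambda>x. c * f x)"
  by (rule Ck_on_mult[OF assms(1) Ck_on_const assms(2)])

lemma Ck_on_diff:
  fixes f g :: "'a::euclidean_space \<Rightarrow> real"
  assumes "open S" "Ck_on k S f" "Ck_on k S g"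
  shows "Ck_on k S (\<lambda>x. f x - g x)"
  using Ck_on_add[OF assms(1,2) Ck_on_cmult[OF assms(1,3), of "-1"]] by simp

lemma Ck_on_inverse:
  fixes f :: "'a::euclidean_space \<Rightarrow> real"
  assumes "open S" "Ck_on k S f" "\<And>x. x \<in> S \<Longrightarrow> f x \<noteq> 0"
  shows "Ck_on k S (\<lambda>x. inverse (f x))"
  using assms(2)
proof (induction k)
  case 0
  then show ?case using assms by (auto intro: continuous_on_inverse)
next
  case (Suc k)
  have IH: "Ck_on k S (\<lambda>x. inverse (f x))" using Suc Ck_on_Suc_imp by blast
  show ?case
  proof (rule Ck_on_SucI[OF assms(1)])
    show "((\<lambda>x. inverse (f x)) has_derivative
        (\<lambda>v. - (inverse (f x) * frechet_derivative f (at x) v * inverse (f x)))) (at x)" if "x \<in> S" for x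
      by (rule Deriv.has_derivative_inverse[OF assms(3)[OF that] Ck_on_has_derivative[OF Suc.prems that]])
    show "Ck_on k S (\<lambda>x. - (inverse (f x) * frechet_derivative f (at x) v * inverse (f x)))" for v
      using Ck_on_cmult[OF assms(1), of k _ "-1"]
        Ck_on_mult[OF assms(1) Ck_on_mult[OF assms(1) IH Ck_on_SucD[OF Suc.prems]] IH]
      by fastforce
  qed
qed

lemma Ck_on_ln:
  fixes f :: "'a::euclidean_space \<Rightarrow> real"
  assumes "open S" "Ck_on k S f" "\<And>x. x \<in> S \<Longrightarrow> f x > 0"
  shows "Ck_on k S (\<lambda>x. ln (f x))"
proof (cases k)
  case 0
  then show ?thesis using assms by (force intro: continuous_on_ln)
next
  case (Suc m)
  have f: "Ck_on (Suc m) S f" using assms Suc by simp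
  have "Ck_on (Suc m) S (\<lambda>x. ln (f x))"
  proof (rule Ck_on_SucI[OF assms(1)])
    fix x assume "x \<in> S"
    then show "((\<lambda>x. ln (f x)) has_derivative (\<lambda>v. frechet_derivative f (at x) v * inverse (f x))) (at x)"
      using has_derivative_ln[OF _ Ck_on_has_derivative[OF f]] assms(3) by (auto simp: divide_inverse mult.commute)
  next
    fix v show "Ck_on m S (\<lambda>x. frechet_derivative f (at x) v * inverse (f x))"
      using f Ck_on_Suc_imp[OF f] assms(1,3) by (intro Ck_on_mult Ck_on_inverse) force+
  qed
  then show ?thesis using Suc by simp
qed

section \<open>Symmetry of second derivatives\<close>

text \<open>Both mixed derivatives are limits of the same second difference quotient, by applying the
  mean value theorem twice in either order.\<close>

lemma second_difference_mean_value:
  fixes f :: "'a::euclidean_space \<Rightarrow> real"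
  assumes C: "Ck_on 2 S f" and h: "h > 0"
    and sub: "\<And>s t. 0 \<le> s \<Longrightarrow> s \<le> h \<Longrightarrow> 0 \<le> t \<Longrightarrow> t \<le> h \<Longrightarrow> x + s *\<^sub>R v + t *\<^sub>R w \<in> S"
  shows "\<exists>s t. 0 < s \<and> s < h \<and> 0 < t \<and> t < h \<and>
     f (x + h *\<^sub>R v + h *\<^sub>R w) - f (x + h *\<^sub>R v) - f (x + h *\<^sub>R w) + f x =
     h * h * frechet_derivative (\<lambda>x. frechet_derivative f (at x) v) (at (x + s *\<^sub>R v + t *\<^sub>R w)) w"
proof -
  have C1: "Ck_on (Suc (Suc 0)) S f" using C by (simp add: numeral_2_eq_2)
  define D where "D = (\<lambda>x. frechet_derivative f (at x) v)"
  have C2: "Ck_on (Suc 0) S D" unfolding D_def by (rule Ck_on_SucD[OF C1])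
  define \<phi> where "\<phi> s = f (x + s *\<^sub>R v + h *\<^sub>R w) - f (x + s *\<^sub>R v)" for s
  have d1: "DERIV (\<lambda>s. f (x + s *\<^sub>R v + t *\<^sub>R w)) s :> D (x + s *\<^sub>R v + t *\<^sub>R w)"
    if "0 \<le> s" "s \<le> h" "0 \<le> t" "t \<le> h" for s t
  proof -
    have "((\<lambda>s. x + s *\<^sub>R v + t *\<^sub>R w) has_derivative (\<lambda>s. s *\<^sub>R v)) (at s)"
      by (auto intro!: derivative_eq_intros)
    from has_derivative_compose[OF this Ck_on_has_derivative[OF C1 sub[OF that]]]
    have der: "((\<lambda>s. f (x + s *\<^sub>R v + t *\<^sub>R w)) has_derivative
       (\<lambda>r. frechet_derivative f (at (x + s *\<^sub>R v + t *\<^sub>R w)) (r *\<^sub>R v))) (at s)" .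
    have "linear (frechet_derivative f (at (x + s *\<^sub>R v + t *\<^sub>R w)))"
      using Ck_on_has_derivative[OF C1 sub[OF that]] has_derivative_linear by blast
    then have "(\<lambda>r. frechet_derivative f (at (x + s *\<^sub>R v + t *\<^sub>R w)) (r *\<^sub>R v))
       = (\<lambda>r. D (x + s *\<^sub>R v + t *\<^sub>R w) * r)" by (auto simp: linear_cmul D_def)
    with der show ?thesis by (simp add: has_field_derivative_def)
  qed
  have "\<exists>s. 0 < s \<and> s < h \<and> \<phi> h - \<phi> 0 = (h - 0) * (D (x + s *\<^sub>R v + h *\<^sub>R w) - D (x + s *\<^sub>R v))"
  proof (rule MVT2[OF h])
    fix s assume "0 \<le> s" "s \<le> h"
    then show "DERIV \<phi> s :> D (x + s *\<^sub>R v + h *\<^sub>R w) - D (x + s *\<^sub>R v)"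
      unfolding \<phi>_def using d1[of s h] d1[of s 0] h by (intro DERIV_diff) auto
  qed
  then obtain s where s: "0 < s" "s < h"
      "\<phi> h - \<phi> 0 = h * (D (x + s *\<^sub>R v + h *\<^sub>R w) - D (x + s *\<^sub>R v))" by auto
  have "\<exists>t. 0 < t \<and> t < h \<and> D (x + s *\<^sub>R v + h *\<^sub>R w) - D (x + s *\<^sub>R v + 0 *\<^sub>R w)
     = (h - 0) * frechet_derivative D (at (x + s *\<^sub>R v + t *\<^sub>R w)) w"
  proof (rule MVT2[OF h])
    fix t assume t: "0 \<le> t" "t \<le> h"
    have S: "x + s *\<^sub>R v + t *\<^sub>R w \<in> S" using sub s t by auto
    have "((\<lambda>t. x + s *\<^sub>R v + t *\<^sub>R w) has_derivative (\<lambda>t. t *\<^sub>R w)) (at t)"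
      by (auto intro!: derivative_eq_intros)
    from has_derivative_compose[OF this Ck_on_has_derivative[OF C2 S]]
    have der: "((\<lambda>t. D (x + s *\<^sub>R v + t *\<^sub>R w)) has_derivative
       (\<lambda>r. frechet_derivative D (at (x + s *\<^sub>R v + t *\<^sub>R w)) (r *\<^sub>R w))) (at t)" .
    have "linear (frechet_derivative D (at (x + s *\<^sub>R v + t *\<^sub>R w)))"
      using Ck_on_has_derivative[OF C2 S] has_derivative_linear by blast
    then have "(\<lambda>r. frechet_derivative D (at (x + s *\<^sub>R v + t *\<^sub>R w)) (r *\<^sub>R w))
       = (\<lambda>r. frechet_derivative D (at (x + s *\<^sub>R v + t *\<^sub>R w)) w * r)" by (auto simp: linear_cmul)
    with der show "DERIV (\<lambda>t. D (x + s *\<^sub>R v + t *\<^sub>R w)) t :>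
        frechet_derivative D (at (x + s *\<^sub>R v + t *\<^sub>R w)) w"
      by (simp add: has_field_derivative_def)
  qed
  then obtain t where t: "0 < t" "t < h" "D (x + s *\<^sub>R v + h *\<^sub>R w) - D (x + s *\<^sub>R v)
     = h * frechet_derivative D (at (x + s *\<^sub>R v + t *\<^sub>R w)) w" by auto
  show ?thesis
    using s t unfolding \<phi>_def D_def by (intro exI[of _ s] exI[of _ t]) (auto simp: algebra_simps)
qed

lemma second_derivative_symmetric_real:
  fixes f :: "'a::euclidean_space \<Rightarrow> real"
  assumes S: "open S" "x \<in> S" and C: "Ck_on 2 S f"
  shows "frechet_derivative (\<lambda>x. frechet_derivative f (at x) v) (at x) w =
         frechet_derivative (\<lambda>x. frechet_derivative f (at x) w) (at x) v"
proof -
  define B where "B v w x = frechet_derivative (\<lambda>x. frechet_derivative f (at x) v) (at x) w" for v w x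
  have cont: "isCont (B v w) x" for v w
    using C S unfolding B_def by (simp add: numeral_2_eq_2 continuous_on_eq_continuous_at)
  have "dist (B v w x) (B w v x) < e" if "e > 0" for e
  proof -
    from cont[of v w] that obtain d1 where d1: "d1 > 0" "\<And>u. dist u x < d1 \<Longrightarrow> dist (B v w u) (B v w x) < e/2"
      unfolding continuous_at_eps_delta by (metis half_gt_zero)
    from cont[of w v] that obtain d2 where d2: "d2 > 0" "\<And>u. dist u x < d2 \<Longrightarrow> dist (B w v u) (B w v x) < e/2"
      unfolding continuous_at_eps_delta by (metis half_gt_zero)
    obtain d3 where d3: "d3 > 0" "ball x d3 \<subseteq> S" using S open_contains_ball by blast
    \<comment> \<open>the parallelogram spanned by \<open>h v\<close> and \<open>h w\<close> at \<open>x\<close> lies in the ball of radius \<open>d\<close>\<close>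
    define d where "d = min d1 (min d2 d3)"
    define h where "h = d / (2 * (norm v + norm w + 1))"
    have pos: "norm v + norm w + 1 > 0" by (smt (verit) norm_ge_zero)
    have d: "d > 0" using d1 d2 d3 by (simp add: d_def)
    have h: "h > 0" using d pos by (simp add: h_def)
    have hd: "h * (norm v + norm w) < d"
    proof -
      have "h * (norm v + norm w) \<le> h * (norm v + norm w + 1)" using h by (simp add: algebra_simps)
      also have "\<dots> = d / 2" using pos by (simp add: h_def field_simps)
      finally show ?thesis using d by simp
    qed
    have near: "dist (x + s *\<^sub>R v + t *\<^sub>R w) x < d" if "0 \<le> s" "s \<le> h" "0 \<le> t" "t \<le> h" for s t
    proof -
      have "dist (x + s *\<^sub>R v + t *\<^sub>R w) x = norm (s *\<^sub>R v + t *\<^sub>R w)" by (simp add: dist_norm algebra_simps)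
      also have "\<dots> \<le> s * norm v + t * norm w" using that norm_triangle_ineq[of "s *\<^sub>R v" "t *\<^sub>R w"] by simp
      also have "\<dots> \<le> h * norm v + h * norm w" using that by (intro add_mono mult_right_mono) auto
      finally show ?thesis using hd by (simp add: algebra_simps)
    qed
    have near': "dist (x + s *\<^sub>R w + t *\<^sub>R v) x < d" if "0 \<le> s" "s \<le> h" "0 \<le> t" "t \<le> h" for s t
      using near[of t s] that by (simp add: algebra_simps)
    have inS: "x + s *\<^sub>R v + t *\<^sub>R w \<in> S" "x + s *\<^sub>R w + t *\<^sub>R v \<in> S"
      if "0 \<le> s" "s \<le> h" "0 \<le> t" "t \<le> h" for s t
      using near[OF that] near'[OF that] d3 by (auto simp: d_def dist_commute subset_iff)
    have "\<exists>s t. 0 < s \<and> s < h \<and> 0 < t \<and> t < h \<and>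
        f (x + h *\<^sub>R v + h *\<^sub>R w) - f (x + h *\<^sub>R v) - f (x + h *\<^sub>R w) + f x
        = h * h * B v w (x + s *\<^sub>R v + t *\<^sub>R w)"
      unfolding B_def by (rule second_difference_mean_value[OF C h inS(1)])
    then obtain s t where st: "0 < s" "s < h" "0 < t" "t < h"
      "f (x + h *\<^sub>R v + h *\<^sub>R w) - f (x + h *\<^sub>R v) - f (x + h *\<^sub>R w) + f x
        = h * h * B v w (x + s *\<^sub>R v + t *\<^sub>R w)" by (elim exE conjE)
    have "\<exists>s t. 0 < s \<and> s < h \<and> 0 < t \<and> t < h \<and>
        f (x + h *\<^sub>R w + h *\<^sub>R v) - f (x + h *\<^sub>R w) - f (x + h *\<^sub>R v) + f x
        = h * h * B w v (x + s *\<^sub>R w + t *\<^sub>R v)"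
      unfolding B_def by (rule second_difference_mean_value[OF C h inS(2)])
    then obtain s' t' where st': "0 < s'" "s' < h" "0 < t'" "t' < h"
      "f (x + h *\<^sub>R w + h *\<^sub>R v) - f (x + h *\<^sub>R w) - f (x + h *\<^sub>R v) + f x
        = h * h * B w v (x + s' *\<^sub>R w + t' *\<^sub>R v)" by (elim exE conjE)
    have "f (x + h *\<^sub>R w + h *\<^sub>R v) = f (x + h *\<^sub>R v + h *\<^sub>R w)" by (simp add: add.assoc add.commute[of "h *\<^sub>R w"])
    with st(5) st'(5) have "h * h * B v w (x + s *\<^sub>R v + t *\<^sub>R w) = h * h * B w v (x + s' *\<^sub>R w + t' *\<^sub>R v)"
      by linarith
    then have eq: "B v w (x + s *\<^sub>R v + t *\<^sub>R w) = B w v (x + s' *\<^sub>R w + t' *\<^sub>R v)" using h by simp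
    have "dist (B v w (x + s *\<^sub>R v + t *\<^sub>R w)) (B v w x) < e/2"
      using d1(2) near[of s t] st by (auto simp: d_def)
    moreover have "dist (B w v (x + s' *\<^sub>R w + t' *\<^sub>R v)) (B w v x) < e/2"
      using d2(2) near'[of s' t'] st' by (auto simp: d_def)
    ultimately show ?thesis unfolding eq by (rule dist_triangle_half_r)
  qed
  from this[of "dist (B v w x) (B w v x)"] have "\<not> 0 < dist (B v w x) (B w v x)" by blast
  then have "B v w x = B w v x" by simp
  then show ?thesis unfolding B_def .
qed

lemma frechet_derivative_inner:
  assumes "f differentiable (at x)"
  shows "frechet_derivative (\<lambda>x. f x \<bullet> b) (at x) v = frechet_derivative f (at x) v \<bullet> b"
proof -
  have "((\<lambda>x. f x \<bullet> b) has_derivative (\<lambda>v. frechet_derivative f (at x) v \<bullet> b)) (at x)"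
    by (rule bounded_linear.has_derivative[OF bounded_linear_inner_left
          frechet_derivative_works[THEN iffD1, OF assms]])
  then show ?thesis by (simp add: frechet_derivative_eqI)
qed

lemma second_derivative_symmetric:
  fixes f :: "'a::euclidean_space \<Rightarrow> 'b::euclidean_space"
  assumes S: "open S" "x \<in> S" and C: "Ck_on 2 S f"
  shows "frechet_derivative (\<lambda>x. frechet_derivative f (at x) v) (at x) w =
         frechet_derivative (\<lambda>x. frechet_derivative f (at x) w) (at x) v"
proof (rule euclidean_eqI)
  fix b :: 'b
  have C2: "Ck_on (Suc (Suc 0)) S f" using C by (simp add: numeral_2_eq_2)
  have Cb: "Ck_on 2 S (\<lambda>x. f x \<bullet> b)"
    using Ck_on_compose_linear[OF S(1) bounded_linear_inner_left C] .
  have eq: "frechet_derivative (\<lambda>x. frechet_derivative f (at x) v) (at x) w \<bullet> b =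
     frechet_derivative (\<lambda>x. frechet_derivative (\<lambda>x. f x \<bullet> b) (at x) v) (at x) w" for v w
  proof -
    have "frechet_derivative (\<lambda>x. frechet_derivative f (at x) v) (at x) w \<bullet> b =
      frechet_derivative (\<lambda>x. frechet_derivative f (at x) v \<bullet> b) (at x) w"
      using C2 S by (intro frechet_derivative_inner[symmetric]) auto
    also have "frechet_derivative (\<lambda>x. frechet_derivative f (at x) v \<bullet> b) (at x) =
       frechet_derivative (\<lambda>x. frechet_derivative (\<lambda>x. f x \<bullet> b) (at x) v) (at x)"
    proof (rule frechet_derivative_transform_within_open[OF _ S])
      show "(\<lambda>x. frechet_derivative f (at x) v \<bullet> b) differentiable at x"
        using C2 S by (intro differentiable_inner) auto
      show "frechet_derivative f (at x) v \<bullet> b = frechet_derivative (\<lambda>x. f x \<bullet> b) (at x) v" if "x \<in> S" for x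
        using C2 that by (intro frechet_derivative_inner[symmetric]) auto
    qed
    finally show ?thesis .
  qed
  show "frechet_derivative (\<lambda>x. frechet_derivative f (at x) v) (at x) w \<bullet> b =
        frechet_derivative (\<lambda>x. frechet_derivative f (at x) w) (at x) v \<bullet> b"
    unfolding eq using second_derivative_symmetric_real[OF S Cb] .
qed

section \<open>The derivative of the determinant\<close>

text \<open>Differentiate the Leibniz formula.  A permutation other than the identity contributes a
  product in which at least two factors are off-diagonal and thus vanish at \<open>x\<close>, so one of them
  is left after differentiating the other factors.\<close>

lemma has_derivative_det_at_mat_1:
  fixes N :: "'a::real_normed_vector \<Rightarrow> real^'n^'n"
  assumes N: "\<And>i j. ((\<lambda>u. N u $ i $ j) has_derivative (\<lambda>h. N' h $ i $ j)) (at x)"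
    and Nx: "N x = mat 1"
  shows "((\<lambda>u. det (N u)) has_derivative (\<lambda>h. trace (N' h))) (at x)"
proof -
  let ?P = "{p. p permutes (UNIV :: 'n set)}"
  define D where "D p h = (\<Sum>i\<in>UNIV. N' h $ i $ p i * (\<Prod>j\<in>UNIV - {i}. N x $ j $ p j))" for p h
  have "((\<lambda>u. \<Sum>p\<in>?P. of_int (sign p) * (\<Prod>i\<in>UNIV. N u $ i $ p i)) has_derivative
     (\<lambda>h. \<Sum>p\<in>?P. of_int (sign p) * D p h)) (at x)"
    unfolding D_def by (intro has_derivative_sum has_derivative_mult_right has_derivative_prod N)
  moreover have "(\<Sum>p\<in>?P. of_int (sign p) * D p h) = trace (N' h)" for h
  proof -
    have "D p h = 0" if p: "p permutes UNIV" "p \<noteq> id" for p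
    proof -
      have "(\<Prod>j\<in>UNIV - {i}. N x $ j $ p j) = 0" for i
      proof -
        \<comment> \<open>a permutation other than the identity moves at least two points\<close>
        obtain k where k: "p k \<noteq> k" using p(2) by (auto simp: fun_eq_iff)
        have "p (p k) \<noteq> p k" using k permutes_inj[OF p(1)] by (auto simp: inj_def)
        then obtain l where "l \<noteq> i" "p l \<noteq> l" using k by (cases "k = i") auto
        then show ?thesis by (intro prod_zero bexI[of _ l]) (auto simp: Nx mat_def)
      qed
      then show ?thesis unfolding D_def by (intro sum.neutral) simp
    qed
    then have "(\<Sum>p\<in>?P. of_int (sign p) * D p h) = (\<Sum>p\<in>{id}. of_int (sign p) * D p h)"
      by (intro sum.mono_neutral_right) (auto simp: permutes_id finite_permutations)
    also have "\<dots> = trace (N' h)" by (simp add: D_def Nx mat_def trace_def)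
    finally show ?thesis .
  qed
  ultimately show ?thesis by (simp add: det_def)
qed

text \<open>Jacobi's formula: multiplication by the inverse \<open>K\<close> of \<open>M x\<close> reduces it to the
  derivative at the identity matrix.\<close>

lemma has_derivative_det:
  fixes M :: "'a::real_normed_vector \<Rightarrow> real^'n^'n"
  assumes M: "\<And>i j. ((\<lambda>u. M u $ i $ j) has_derivative (\<lambda>h. M' h $ i $ j)) (at x)"
    and inv: "K ** M x = mat 1" "M x ** K = mat 1"
  shows "((\<lambda>u. det (M u)) has_derivative (\<lambda>h. det (M x) * trace (K ** M' h))) (at x)"
proof -
  have "((\<lambda>u. det (K ** M u)) has_derivative (\<lambda>h. trace (K ** M' h))) (at x)"
  proof (rule has_derivative_det_at_mat_1)
    show "((\<lambda>u. (K ** M u) $ i $ j) has_derivative (\<lambda>h. (K ** M' h) $ i $ j)) (at x)" for i j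
      by (simp add: matrix_matrix_mult_def) (intro has_derivative_sum has_derivative_mult_right M)
  qed (rule inv)
  then have "((\<lambda>u. det (M x) * det (K ** M u)) has_derivative
      (\<lambda>h. det (M x) * trace (K ** M' h))) (at x)"
    by (rule has_derivative_mult_right)
  moreover have "det (M x) * det (K ** M u) = det (M u)" for u
    by (simp add: det_mul[symmetric] matrix_mul_assoc inv)
  ultimately show ?thesis by simp
qed

section \<open>The S-curvature under a change of coordinates\<close>

lemma linear_eq_sum_axis:
  fixes L :: "real^'n \<Rightarrow> 'b::real_vector"
  assumes "linear L"
  shows "L v = (\<Sum>m\<in>UNIV. v $ m *\<^sub>R L (axis m 1))"
proof -
  have "L v = L (\<Sum>m\<in>UNIV. v $ m *\<^sub>R axis m 1)"
    using basis_expansion[of v] by (simp add: scalar_mult_eq_scaleR)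
  then show ?thesis using assms by (simp add: linear_sum linear_cmul)
qed

lemma frechet_derivative_eq_sum_pd:
  assumes "f differentiable (at x)"
  shows "frechet_derivative f (at x) v = (\<Sum>m\<in>UNIV. v $ m * pd m f x)"
  using linear_eq_sum_axis[OF linear_frechet_derivative[OF assms], of v] by (simp add: pd_def)

lemma linear_on_factors:
  assumes "linear D"
  shows "linear (\<lambda>a. D (a, 0))" "linear (\<lambda>b. D (0, b))"
proof -
  have "linear (\<lambda>a. (a, 0))" "linear (\<lambda>b. (0, b))" by (auto intro: linearI)
  from this[THEN linear_compose[OF _ assms]] show "linear (\<lambda>a. D (a, 0))" "linear (\<lambda>b. D (0, b))"
    by (simp_all only: o_def)
qed

lemma frechet_derivative_eq_sum_pdx_pdy:
  fixes a b :: "real^'n"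
  assumes "f differentiable (at z)"
  shows "frechet_derivative f (at z) (a, b) = (\<Sum>m\<in>UNIV. a $ m * pdx m f z) + (\<Sum>m\<in>UNIV. b $ m * pdy m f z)"
proof -
  let ?D = "frechet_derivative f (at z)"
  have lin: "linear ?D" by (rule linear_frechet_derivative[OF assms])
  have lin2: "linear (\<lambda>a. ?D (a, 0))" "linear (\<lambda>b. ?D (0, b))"
    by (rule linear_on_factors[OF lin])+
  have "?D (a, 0) = (\<Sum>m\<in>UNIV. a $ m * pdx m f z)"
    using linear_eq_sum_axis[OF lin2(1), of a] by (simp add: pdx_def)
  moreover have "?D (0, b) = (\<Sum>m\<in>UNIV. b $ m * pdy m f z)"
    using linear_eq_sum_axis[OF lin2(2), of b] by (simp add: pdy_def)
  moreover have "?D (a, b) = ?D (a, 0) + ?D (0, b)" using linear_add[OF lin, of "(a, 0)" "(0, b)"] by simp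
  ultimately show ?thesis by simp
qed

lemma frechet_derivative_vec_nth:
  fixes H :: "'a::real_normed_vector \<Rightarrow> real^'n"
  assumes "H differentiable (at z)"
  shows "frechet_derivative (\<lambda>u. H u $ i) (at z) v = frechet_derivative H (at z) v $ i"
proof -
  have "((\<lambda>u. H u $ i) has_derivative (\<lambda>v. frechet_derivative H (at z) v $ i)) (at z)"
    by (rule bounded_linear.has_derivative[OF bounded_linear_vec_nth
        frechet_derivative_works[THEN iffD1, OF assms]])
  then show ?thesis by (simp add: frechet_derivative_eqI)
qed

definition S_coord :: "((real^'n) \<times> (real^'n) \<Rightarrow> real^'n) \<Rightarrow> (real^'n \<Rightarrow> real) \<Rightarrow>
    (real^'n) \<times> (real^'n) \<Rightarrow> real" where
  "S_coord H \<sigma> z = (\<Sum>m\<in>UNIV. pdy m (\<lambda>u. H u $ m) z)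
     - (\<Sum>m\<in>UNIV. snd z $ m * pd m (\<lambda>x. ln (\<sigma> x)) (fst z))"

lemma S_coord_eq_trace:
  assumes "H differentiable (at (x, y))" "(\<lambda>x. ln (\<sigma> x)) differentiable (at x)"
  shows "S_coord H \<sigma> (x, y) = trace (matrix (\<lambda>v. frechet_derivative H (at (x, y)) (0, v)))
    - frechet_derivative (\<lambda>x. ln (\<sigma> x)) (at x) y"
  by (simp add: S_coord_def trace_def matrix_def pdy_def frechet_derivative_vec_nth[OF assms(1)]
      frechet_derivative_eq_sum_pd[OF assms(2)])

lemma matrix_mult_eqI:
  fixes f g :: "real^'n \<Rightarrow> real^'n"
  assumes "linear f" "linear g"
  shows "matrix f ** matrix g = matrix (\<lambda>v. f (g v))"
  using matrix_compose[OF assms(2,1)] by (simp add: o_def)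

lemma matrix_diff: "matrix (\<lambda>v. f v - g v) = matrix f - matrix g"
  by (simp add: matrix_def vec_eq_iff)

lemma matrix_mult_diff_right:
  fixes A :: "real^'n^'m" and B C :: "real^'p^'n"
  shows "A ** (B - C) = A ** B - A ** C"
  by (simp add: matrix_matrix_mult_def vec_eq_iff right_diff_distrib sum_subtractf)

text \<open>Differentiating the transformation law of the spray coefficients with respect to \<open>y\<close>
  shows that the trace in \<open>S_coord\<close> changes by the trace of \<open>inverse J \<cdot> D\<^sup>2\<tau>(y, \<cdot>)\<close>.  By Jacobi's
  formula this is the derivative of \<open>ln \<bar>det J\<bar>\<close> along \<open>y\<close>, by which the term with the density
  changes.  The quadratic form \<open>D\<^sup>2\<tau>(y, y)\<close> in the law has the derivative
  \<open>2 D\<^sup>2\<tau>(y, \<cdot>)\<close> because second derivatives are symmetric.\<close>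

lemma S_coord_change:
  fixes \<tau> :: "real^'n \<Rightarrow> real^'n"
  defines "J \<equiv> \<lambda>u. frechet_derivative \<tau> (at u)"
  assumes U: "open U" "x \<in> U" and \<tau>: "Ck_on 2 U \<tau>" and y: "y \<noteq> 0"
    and G1: "G1 differentiable (at (x, y))" and G2: "G2 differentiable (at (\<tau> x, J x y))"
    and law: "\<And>v. v \<noteq> 0 \<Longrightarrow> G2 (\<tau> x, J x v) = J x (G1 (x, v))
        - (1/2) *\<^sub>R frechet_derivative (\<lambda>u. J u v) (at x) v"
    and s1: "\<And>u. u \<in> U \<Longrightarrow> \<sigma>1 u > 0" and s2: "\<sigma>2 (\<tau> x) > 0" "\<sigma>2 differentiable (at (\<tau> x))"
    and s12: "\<And>u. u \<in> U \<Longrightarrow> \<sigma>1 u = \<sigma>2 (\<tau> u) * \<bar>det (matrix (J u))\<bar>"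
  shows "S_coord G1 \<sigma>1 (x, y) = S_coord G2 \<sigma>2 (\<tau> x, J x y)"
proof -
  have C1: "Ck_on (Suc (Suc 0)) U \<tau>" using \<tau> by (simp add: numeral_2_eq_2)
  have J: "(\<tau> has_derivative J u) (at u)" if "u \<in> U" for u
    unfolding J_def by (rule Ck_on_has_derivative[OF C1 that])
  have linJ: "linear (J u)" if "u \<in> U" for u using J[OF that] by (rule has_derivative_linear)
  define B where "B v = frechet_derivative (\<lambda>u. J u v) (at x)" for v
  have B: "((\<lambda>u. J u v) has_derivative B v) (at x)" for v
    using Ck_on_has_derivative[OF Ck_on_SucD[OF C1] U(2)] unfolding B_def J_def .
  have sym: "B v w = B w v" for v w
    unfolding B_def J_def by (rule second_derivative_symmetric[OF U \<tau>])
  have linB: "linear (B v)" for v by (rule has_derivative_linear[OF B])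
  have "bilinear B" unfolding bilinear_def using linB sym by simp
  then interpret B: bounded_bilinear B by (simp add: bilinear_conv_bounded_bilinear)
  have dety: "det (matrix (J x)) \<noteq> 0" using s1[OF U(2)] s12[OF U(2)] s2 by auto
  then have "invertible (matrix (J x))" by (simp add: invertible_det_nz)
  then obtain K where K: "K ** matrix (J x) = mat 1" "matrix (J x) ** K = mat 1"
    unfolding invertible_def by blast
  define D1 where "D1 = (\<lambda>v. frechet_derivative G1 (at (x, y)) (0, v))"
  define D2 where "D2 = (\<lambda>v. frechet_derivative G2 (at (\<tau> x, J x y)) (0, v))"
  have pair: "((\<lambda>v. (c, v)) has_derivative (\<lambda>h. (0, h))) (at y)" for c :: "real^'n"
    by (auto intro!: derivative_eq_intros)
  have d1: "((\<lambda>v. G1 (x, v)) has_derivative D1) (at y)"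
    unfolding D1_def using has_derivative_compose[OF pair frechet_derivative_works[THEN iffD1, OF G1]] .
  have Jx: "(J x has_derivative J x) (at y)"
    using linJ[OF U(2)] by (simp add: linear_imp_has_derivative)
  have "((\<lambda>v. (\<tau> x, J x v)) has_derivative (\<lambda>h. (0, J x h))) (at y)"
    by (rule has_derivative_Pair[OF has_derivative_const Jx])
  from has_derivative_compose[OF this frechet_derivative_works[THEN iffD1, OF G2]]
  have d2: "((\<lambda>v. G2 (\<tau> x, J x v)) has_derivative (\<lambda>h. D2 (J x h))) (at y)"
    unfolding D2_def .
  have "((\<lambda>v. J x (G1 (x, v)) - (1/2) *\<^sub>R B v v) has_derivative
      (\<lambda>h. J x (D1 h) - (1/2) *\<^sub>R (B y h + B h y))) (at y)"
    by (intro has_derivative_diff has_derivative_scaleR_right B.FDERIV has_derivative_ident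
        has_derivative_compose[OF d1 linear_imp_has_derivative[OF linJ[OF U(2)]]])
  then have "((\<lambda>v. G2 (\<tau> x, J x v)) has_derivative
      (\<lambda>h. J x (D1 h) - (1/2) *\<^sub>R (B y h + B h y))) (at y)"
    by (rule has_derivative_transform_within_open[of _ _ _ _ "- {0}"]) (use y law in \<open>auto simp: B_def\<close>)
  from has_derivative_unique[OF d2 this] have "D2 (J x h) = J x (D1 h) - (1/2) *\<^sub>R (B y h + B h y)" for h
    by (rule fun_cong)
  then have eq: "D2 (J x h) = J x (D1 h) - B y h" for h by (simp add: sym[of h y] flip: scaleR_2)
  have linD: "linear D1" "linear D2"
    unfolding D1_def D2_def
    by (rule linear_on_factors(2)[OF linear_frechet_derivative[OF G1]],
        rule linear_on_factors(2)[OF linear_frechet_derivative[OF G2]])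
  have "matrix D2 ** matrix (J x) = matrix (J x) ** matrix D1 - matrix (B y)"
    using linD linJ[OF U(2)] by (simp add: matrix_mult_eqI eq matrix_diff)
  then have "matrix D2 ** matrix (J x) ** K = (matrix (J x) ** matrix D1 - matrix (B y)) ** K" by simp
  then have "matrix D2 = (matrix (J x) ** matrix D1 - matrix (B y)) ** K"
    by (simp add: matrix_mul_assoc[symmetric] K)
  then have "trace (matrix D2) = trace ((matrix (J x) ** matrix D1 - matrix (B y)) ** K)"
    by (rule arg_cong)
  also have "\<dots> = trace (K ** (matrix (J x) ** matrix D1 - matrix (B y)))"
    by (rule trace_mul_sym)
  also have "K ** (matrix (J x) ** matrix D1 - matrix (B y)) = matrix D1 - K ** matrix (B y)"
    by (simp add: matrix_mult_diff_right matrix_mul_assoc K)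
  finally have tr: "trace (matrix D2) = trace (matrix D1) - trace (K ** matrix (B y))"
    by (simp add: trace_sub)
  have dJ: "((\<lambda>u. matrix (J u) $ i $ j) has_derivative (\<lambda>h. matrix (\<lambda>v. B v h) $ i $ j)) (at x)" for i j
    unfolding matrix_def using bounded_linear.has_derivative[OF bounded_linear_vec_nth B] by simp
  have ddet: "((\<lambda>u. det (matrix (J u))) has_derivative
       (\<lambda>h. det (matrix (J x)) * trace (K ** matrix (\<lambda>v. B v h)))) (at x)"
    by (rule has_derivative_det[OF dJ K])
  have ds2: "(\<sigma>2 has_derivative frechet_derivative \<sigma>2 (at (\<tau> x))) (at (\<tau> x))"
    by (rule frechet_derivative_works[THEN iffD1, OF s2(2)])
  have dln2: "((\<lambda>x. ln (\<sigma>2 x)) has_derivative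
     (\<lambda>h. inverse (\<sigma>2 (\<tau> x)) * frechet_derivative \<sigma>2 (at (\<tau> x)) h)) (at (\<tau> x))"
    using has_derivative_ln[OF s2(1) ds2] by (simp add: divide_inverse mult.commute)
  have L2: "(\<lambda>x. ln (\<sigma>2 x)) differentiable (at (\<tau> x))" using dln2 by (auto simp: differentiable_def)
  let ?l2 = "frechet_derivative (\<lambda>x. ln (\<sigma>2 x)) (at (\<tau> x))"
  have c2: "((\<lambda>u. ln (\<sigma>2 (\<tau> u))) has_derivative (\<lambda>h. ?l2 (J x h))) (at x)"
    by (rule has_derivative_compose[OF J[OF U(2)] frechet_derivative_works[THEN iffD1, OF L2]])
  \<comment> \<open>the absolute value is avoided by writing \<open>ln \<bar>d\<bar>\<close> as half of \<open>ln (d * d)\<close>\<close>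
  have lndet: "((\<lambda>u. ln \<bar>det (matrix (J u))\<bar>) has_derivative (\<lambda>h. trace (K ** matrix (\<lambda>v. B v h)))) (at x)"
  proof -
    let ?d = "\<lambda>u. det (matrix (J u))"
    have "((\<lambda>u. 1/2 * ln (?d u * ?d u)) has_derivative
      (\<lambda>h. trace (K ** matrix (\<lambda>v. B v h)))) (at x)"
    proof -
      have "?d x * ?d x > 0" using dety by (simp add: zero_less_mult_iff) linarith
      note d = has_derivative_mult_right[OF has_derivative_ln[OF this has_derivative_mult[OF ddet ddet]], of "1/2"]
      show ?thesis
        by (rule has_derivative_eq_rhs[OF d]) (use dety in \<open>auto simp: field_simps\<close>)
    qed
    moreover have "ln \<bar>d\<bar> = 1/2 * ln (d * d)" for d :: real
      by (simp add: ln_mult abs_if ln_minus)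
    ultimately show ?thesis by (simp only:)
  qed
  have "((\<lambda>u. ln (\<sigma>2 (\<tau> u)) + ln \<bar>det (matrix (J u))\<bar>) has_derivative
      (\<lambda>h. ?l2 (J x h) + trace (K ** matrix (\<lambda>v. B v h)))) (at x)"
    by (rule has_derivative_add[OF c2 lndet])
  then have dln1: "((\<lambda>u. ln (\<sigma>1 u)) has_derivative (\<lambda>h. ?l2 (J x h) + trace (K ** matrix (\<lambda>v. B v h)))) (at x)"
  proof (rule has_derivative_transform_within_open[OF _ U])
    fix u assume u: "u \<in> U"
    have "\<sigma>2 (\<tau> u) > 0" "\<bar>det (matrix (J u))\<bar> > 0"
      using s1[OF u] s12[OF u] by (auto simp: zero_less_mult_iff)
    then show "ln (\<sigma>2 (\<tau> u)) + ln \<bar>det (matrix (J u))\<bar> = ln (\<sigma>1 u)"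
      using s12[OF u] by (simp add: ln_mult)
  qed
  have L1: "(\<lambda>x. ln (\<sigma>1 x)) differentiable (at x)" using dln1 by (auto simp: differentiable_def)
  have "frechet_derivative (\<lambda>x. ln (\<sigma>1 x)) (at x) y = ?l2 (J x y) + trace (K ** matrix (B y))"
    using frechet_derivative_eqI[OF dln1] sym[of _ y] by simp
  then show ?thesis
    using tr unfolding S_coord_eq_trace[OF G1 L1] S_coord_eq_trace[OF G2 L2] D1_def D2_def by simp
qed

section \<open>The Ricci curvature under a projective change\<close>

text \<open>The quadratic term of the Ricci curvature, with \<open>a m s\<close> for \<open>\<partial>G\<^sup>m/\<partial>y\<^sup>s\<close>, \<open>p s\<close> for
  \<open>\<partial>P/\<partial>y\<^sup>s\<close> and \<open>g m\<close> for \<open>G\<^sup>m\<close>; the hypotheses are Euler's identities for \<open>G\<close> and \<open>P\<close>.\<close>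

lemma sum_projective_square:
  fixes a :: "'n::finite \<Rightarrow> 'n \<Rightarrow> real" and p y g :: "'n \<Rightarrow> real"
  assumes ay: "\<And>m. (\<Sum>s\<in>UNIV. y s * a m s) = 2 * g m" and py: "(\<Sum>s\<in>UNIV. y s * p s) = P"
  shows "(\<Sum>m\<in>UNIV. \<Sum>s\<in>UNIV. (a m s - p s * y m - (if s = m then P else 0))
             * (a s m - p m * y s - (if m = s then P else 0)))
     = (\<Sum>m\<in>UNIV. \<Sum>s\<in>UNIV. a m s * a s m)
       - 4 * (\<Sum>m\<in>UNIV. g m * p m) - 2 * P * (\<Sum>m\<in>UNIV. a m m) + (real CARD('n) + 3) * P\<^sup>2"
proof -
  have swap: "(\<Sum>m\<in>UNIV. \<Sum>s\<in>UNIV. a s m * (p s * y m)) = (\<Sum>m\<in>UNIV. \<Sum>s\<in>UNIV. a m s * (p m * y s))"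
    by (rule sum.swap)
  have inner: "(\<Sum>s\<in>UNIV. a m s * (p m * y s)) = 2 * (g m * p m)" for m
  proof -
    have "(\<Sum>s\<in>UNIV. a m s * (p m * y s)) = p m * (\<Sum>s\<in>UNIV. y s * a m s)"
      by (simp add: sum_distrib_left mult_ac)
    then show ?thesis by (simp add: ay)
  qed
  have apy: "(\<Sum>m\<in>UNIV. \<Sum>s\<in>UNIV. a m s * (p m * y s)) = 2 * (\<Sum>m\<in>UNIV. g m * p m)"
    unfolding inner by (rule sum_distrib_left[symmetric])
  have pypy: "(\<Sum>m\<in>UNIV. \<Sum>s\<in>UNIV. (p s * y s) * (p m * y m)) = P\<^sup>2"
  proof -
    have "(\<Sum>m\<in>UNIV. \<Sum>s\<in>UNIV. (p s * y s) * (p m * y m)) = (\<Sum>s\<in>UNIV. y s * p s) * (\<Sum>m\<in>UNIV. y m * p m)"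
      unfolding sum_product by (subst sum.swap) (simp add: mult_ac)
    then show ?thesis by (simp add: py power2_eq_square)
  qed
  have py': "(\<Sum>m\<in>UNIV. p m * y m) = P" using py by (simp add: mult.commute)
  have expand: "(a m s - p s * y m - (if s = m then P else 0)) * (a s m - p m * y s - (if m = s then P else 0))
     = a m s * a s m - a m s * (p m * y s) - a s m * (p s * y m) + (p s * y s) * (p m * y m)
       + (if s = m then - 2 * P * a m m + 2 * P * (p m * y m) + P\<^sup>2 else 0)" for m s
    by (cases "s = m") (simp_all add: algebra_simps power2_eq_square)
  show ?thesis unfolding expand sum.distrib sum_subtractf swap apy pypy
    by (simp add: sum.distrib sum_subtractf sum_negf flip: sum_distrib_left add: py')
       (simp add: algebra_simps power2_eq_square)
qed

text \<open>The second derivatives of the coefficients enter the Ricci curvature only through the vertical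
  divergence \<open>\<partial>H\<^sup>m/\<partial>y\<^sup>m\<close>.\<close>

lemma ricci_coord_eq_divergence:
  assumes H: "\<And>m. pdy m (\<lambda>u. H u $ m) differentiable (at z)"
  shows "ricci_coord H z = 2 * (\<Sum>m\<in>UNIV. pdx m (\<lambda>u. H u $ m) z)
     - (\<Sum>j\<in>UNIV. snd z $ j * pdx j (\<lambda>u. \<Sum>m\<in>UNIV. pdy m (\<lambda>u. H u $ m) u) z)
     + 2 * (\<Sum>j\<in>UNIV. H z $ j * pdy j (\<lambda>u. \<Sum>m\<in>UNIV. pdy m (\<lambda>u. H u $ m) u) z)
     - (\<Sum>m\<in>UNIV. \<Sum>s\<in>UNIV. pdy s (\<lambda>u. H u $ m) z * pdy m (\<lambda>u. H u $ s) z)"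
proof -
  have D: "frechet_derivative (\<lambda>u. \<Sum>m\<in>UNIV. pdy m (\<lambda>u. H u $ m) u) (at z)
     = (\<lambda>v. \<Sum>m\<in>UNIV. frechet_derivative (pdy m (\<lambda>u. H u $ m)) (at z) v)"
    by (rule frechet_derivative_eqI) (intro has_derivative_sum frechet_derivative_works[THEN iffD1] H)
  have swap: "(\<Sum>j\<in>UNIV. c j * (\<Sum>m\<in>UNIV. d m j)) = (\<Sum>m\<in>UNIV. \<Sum>j\<in>UNIV. c j * d m j)"
    for c :: "'n \<Rightarrow> real" and d
    unfolding sum_distrib_left by (rule sum.swap)
  show ?thesis
    unfolding ricci_coord_def riemann_coord_def pdx_def[of _ "\<lambda>u. \<Sum>m\<in>UNIV. pdy m (\<lambda>u. H u $ m) u"]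
      pdy_def[of _ "\<lambda>u. \<Sum>m\<in>UNIV. pdy m (\<lambda>u. H u $ m) u"] D swap
    by (simp add: sum.distrib sum_subtractf sum_distrib_left pdx_def pdy_def)
qed

lemma Ck_on_pdy:
  assumes "Ck_on (Suc k) U f" shows "Ck_on k U (pdy m f)"
  unfolding pdy_def[abs_def] by (rule Ck_on_SucD[OF assms])

text \<open>By Euler's identity the vertical divergence of \<open>G - P y\<close> is \<open>N - (n + 1) P\<close>, so only first
  derivatives of \<open>P\<close> survive.  The multiples of \<open>P N\<close> cancel, and collecting the remaining terms
  gives \<open>n - 1\<close> times the derivative of \<open>P\<close> along the spray plus \<open>P\<^sup>2\<close>.\<close>

lemma ricci_coord_projective_change:
  fixes G :: "(real^'n) \<times> (real^'n) \<Rightarrow> real^'n" and P :: "(real^'n) \<times> (real^'n) \<Rightarrow> real"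
  defines "N \<equiv> \<lambda>u. \<Sum>m\<in>UNIV. pdy m (\<lambda>u. G u $ m) u"
  assumes U: "open U" "z \<in> U" and CG: "\<And>i. Ck_on 2 U (\<lambda>u. G u $ i)" and CP: "Ck_on 2 U P"
    and eulerG: "\<And>i. (\<Sum>s\<in>UNIV. snd z $ s * pdy s (\<lambda>u. G u $ i) z) = 2 * G z $ i"
    and eulerP: "\<And>u. u \<in> U \<Longrightarrow> (\<Sum>s\<in>UNIV. snd u $ s * pdy s P u) = P u"
    and eulerN: "(\<Sum>s\<in>UNIV. snd z $ s * pdy s N z) = N z"
  shows "ricci_coord (\<lambda>u. G u - P u *\<^sub>R snd u) z = ricci_coord G z + (real CARD('n) - 1) *
    ((\<Sum>j\<in>UNIV. snd z $ j * pdx j P z) - 2 * (\<Sum>j\<in>UNIV. G z $ j * pdy j P z) + (P z)\<^sup>2)"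
proof -
  let ?n = "real CARD('n)"
  define H where "H = (\<lambda>u. G u - P u *\<^sub>R snd u)"
  have C2: "Ck_on (Suc (Suc 0)) U f" if "Ck_on 2 U f" for f :: "(real^'n) \<times> (real^'n) \<Rightarrow> real"
    using that by (simp add: numeral_2_eq_2)
  have Cy: "Ck_on k U (\<lambda>u. snd u $ i)" for k i
    by (rule Ck_on_bounded_linear)
      (rule bounded_linear_compose[OF bounded_linear_vec_nth bounded_linear_snd])
  have Hi: "H u $ i = G u $ i - P u * snd u $ i" for u i by (simp add: H_def)
  have CH: "Ck_on 2 U (\<lambda>u. H u $ i)" for i
    unfolding Hi by (intro Ck_on_diff Ck_on_mult U CG CP Cy)
  have DH: "((\<lambda>u. H u $ i) has_derivative (\<lambda>v. frechet_derivative (\<lambda>u. G u $ i) (at u) v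
      - (P u * snd v $ i + frechet_derivative P (at u) v * snd u $ i))) (at u)" if "u \<in> U" for u i
  proof -
    have y: "((\<lambda>u. snd u $ i) has_derivative (\<lambda>v. snd v $ i)) (at u)"
      by (rule bounded_linear_imp_has_derivative)
        (rule bounded_linear_compose[OF bounded_linear_vec_nth bounded_linear_snd])
    show ?thesis unfolding Hi
      by (rule has_derivative_diff[OF Ck_on_has_derivative[OF C2[OF CG] that]
          has_derivative_mult[OF Ck_on_has_derivative[OF C2[OF CP] that] y]])
  qed
  have dx: "pdx j (\<lambda>u. H u $ i) u = pdx j (\<lambda>u. G u $ i) u - pdx j P u * snd u $ i" if "u \<in> U" for u i j
    unfolding pdx_def frechet_derivative_eqI[OF DH[OF that]] by simp
  have dy: "pdy s (\<lambda>u. H u $ i) u = pdy s (\<lambda>u. G u $ i) u - pdy s P u * snd u $ i - (if s = i then P u else 0)"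
    if "u \<in> U" for u i s
    unfolding pdy_def frechet_derivative_eqI[OF DH[OF that]] by (simp add: axis_def)
  define NH where "NH = (\<lambda>u. \<Sum>m\<in>UNIV. pdy m (\<lambda>u. H u $ m) u)"
  have NH: "NH u = N u - (?n + 1) * P u" if "u \<in> U" for u
    using eulerP[OF that] unfolding NH_def N_def dy[OF that]
    by (simp add: sum_subtractf sum.distrib mult.commute algebra_simps)
  have dG: "pdy m (\<lambda>u. G u $ m) differentiable (at z)" and dH: "pdy m (\<lambda>u. H u $ m) differentiable (at z)" for m
    using Ck_on_pdy[OF C2[OF CG]] Ck_on_pdy[OF C2[OF CH]] U(2) by auto
  have dN: "N differentiable (at z)" unfolding N_def using dG by (intro differentiable_sum) auto
  have dP: "P differentiable (at z)" using C2[OF CP] U(2) by simp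
  have "((\<lambda>u. N u - (?n + 1) * P u) has_derivative (\<lambda>v. frechet_derivative N (at z) v
      - (?n + 1) * frechet_derivative P (at z) v)) (at z)"
    by (intro has_derivative_diff has_derivative_mult_right frechet_derivative_works[THEN iffD1] dN dP)
  then have "(NH has_derivative (\<lambda>v. frechet_derivative N (at z) v
      - (?n + 1) * frechet_derivative P (at z) v)) (at z)"
    by (rule has_derivative_transform_within_open[OF _ U]) (simp add: NH)
  then have DNH: "frechet_derivative NH (at z) = (\<lambda>v. frechet_derivative N (at z) v
      - (?n + 1) * frechet_derivative P (at z) v)"
    by (rule frechet_derivative_eqI)
  have NHx: "pdx j NH z = pdx j N z - (?n + 1) * pdx j P z" and
    NHy: "pdy j NH z = pdy j N z - (?n + 1) * pdy j P z" for j
    unfolding pdx_def pdy_def DNH by simp_all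
  have t1: "(\<Sum>m\<in>UNIV. pdx m (\<lambda>u. H u $ m) z) =
      (\<Sum>m\<in>UNIV. pdx m (\<lambda>u. G u $ m) z) - (\<Sum>j\<in>UNIV. snd z $ j * pdx j P z)"
    unfolding dx[OF U(2)] by (simp add: sum_subtractf mult.commute)
  have t2: "(\<Sum>j\<in>UNIV. snd z $ j * pdx j NH z) =
      (\<Sum>j\<in>UNIV. snd z $ j * pdx j N z) - (?n + 1) * (\<Sum>j\<in>UNIV. snd z $ j * pdx j P z)"
    unfolding NHx by (simp add: sum_subtractf sum_distrib_left algebra_simps sum.distrib)
  have t3: "(\<Sum>j\<in>UNIV. H z $ j * pdy j NH z) =
      (\<Sum>j\<in>UNIV. G z $ j * pdy j N z) - (?n + 1) * (\<Sum>j\<in>UNIV. G z $ j * pdy j P z)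
       - P z * N z + (?n + 1) * (P z)\<^sup>2"
  proof -
    have "(\<Sum>j\<in>UNIV. H z $ j * pdy j NH z) =
      (\<Sum>j\<in>UNIV. G z $ j * pdy j N z - (?n + 1) * (G z $ j * pdy j P z)
        - P z * (snd z $ j * pdy j N z) + (?n + 1) * P z * (snd z $ j * pdy j P z))"
      unfolding NHy Hi by (intro sum.cong) (simp_all add: algebra_simps)
    also have "\<dots> = (\<Sum>j\<in>UNIV. G z $ j * pdy j N z) - (?n + 1) * (\<Sum>j\<in>UNIV. G z $ j * pdy j P z)
        - P z * (\<Sum>j\<in>UNIV. snd z $ j * pdy j N z) + (?n + 1) * P z * (\<Sum>j\<in>UNIV. snd z $ j * pdy j P z)"
      unfolding sum.distrib sum_subtractf sum_distrib_left ..
    finally show ?thesis unfolding eulerN eulerP[OF U(2)] by (simp add: power2_eq_square)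
  qed
  have t4: "(\<Sum>m\<in>UNIV. \<Sum>s\<in>UNIV. pdy s (\<lambda>u. H u $ m) z * pdy m (\<lambda>u. H u $ s) z)
    = (\<Sum>m\<in>UNIV. \<Sum>s\<in>UNIV. pdy s (\<lambda>u. G u $ m) z * pdy m (\<lambda>u. G u $ s) z)
      - 4 * (\<Sum>m\<in>UNIV. G z $ m * pdy m P z) - 2 * P z * N z + (?n + 3) * (P z)\<^sup>2"
    unfolding dy[OF U(2)] N_def
    by (rule sum_projective_square[of "\<lambda>s. snd z $ s" "\<lambda>m s. pdy s (\<lambda>u. G u $ m) z"])
       (use eulerG eulerP[OF U(2)] in auto)
  have "ricci_coord H z = ricci_coord G z + (?n - 1) *
    ((\<Sum>j\<in>UNIV. snd z $ j * pdx j P z) - 2 * (\<Sum>j\<in>UNIV. G z $ j * pdy j P z) + (P z)\<^sup>2)"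
    unfolding ricci_coord_eq_divergence[of H, OF dH] ricci_coord_eq_divergence[of G, OF dG]
      NH_def[symmetric] N_def[symmetric] t1 t2 t3 t4
    by (simp add: algebra_simps)
  then show ?thesis unfolding H_def .
qed

lemma euler_pdy:
  fixes f :: "(real^'n) \<times> (real^'n) \<Rightarrow> real"
  assumes "f differentiable (at (x, y))" "\<And>r. r > 0 \<Longrightarrow> f (x, r *\<^sub>R y) = r ^ k * f (x, y)"
  shows "(\<Sum>s\<in>UNIV. y $ s * pdy s f (x, y)) = real k * f (x, y)"
proof -
  have "((\<lambda>r. (x, r *\<^sub>R y)) has_derivative (\<lambda>h. (0, h *\<^sub>R y))) (at 1)"
    by (auto intro!: derivative_eq_intros)
  moreover have "(f has_derivative frechet_derivative f (at (x, y))) (at (x, 1 *\<^sub>R y))"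
    using assms(1) by (simp add: frechet_derivative_works[symmetric])
  ultimately have 1: "((\<lambda>r. f (x, r *\<^sub>R y)) has_derivative (\<lambda>h. frechet_derivative f (at (x, y)) (0, h *\<^sub>R y))) (at 1)"
    by (rule has_derivative_compose)
  have "((\<lambda>r. r ^ k * f (x, y)) has_derivative (\<lambda>h. real k * h * f (x, y))) (at 1)"
    by (auto intro!: derivative_eq_intros)
  then have "((\<lambda>r. f (x, r *\<^sub>R y)) has_derivative (\<lambda>h. real k * h * f (x, y))) (at 1)"
    by (rule has_derivative_transform_within_open[of _ _ _ _ "{0<..}"]) (auto simp: assms(2))
  from has_derivative_unique[OF 1 this]
  have "frechet_derivative f (at (x, y)) (0, 1 *\<^sub>R y) = real k * 1 * f (x, y)" by (rule fun_cong)
  then show ?thesis by (simp add: frechet_derivative_eq_sum_pdx_pdy[OF assms(1)])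
qed

lemma pdy_homogeneous:
  fixes f :: "(real^'n) \<times> (real^'n) \<Rightarrow> real"
  assumes d: "f differentiable (at (x, y))" "f differentiable (at (x, r *\<^sub>R y))" and r: "r > 0"
    and y: "y \<noteq> 0" and hom: "\<And>v. v \<noteq> 0 \<Longrightarrow> f (x, r *\<^sub>R v) = r ^ Suc k * f (x, v)"
  shows "pdy m f (x, r *\<^sub>R y) = r ^ k * pdy m f (x, y)"
proof -
  have "((\<lambda>v. (x, r *\<^sub>R v)) has_derivative (\<lambda>h. (0, r *\<^sub>R h))) (at y)"
    by (auto intro!: derivative_eq_intros)
  from has_derivative_compose[OF this frechet_derivative_works[THEN iffD1, OF d(2)]]
  have 1: "((\<lambda>v. f (x, r *\<^sub>R v)) has_derivative
      (\<lambda>h. frechet_derivative f (at (x, r *\<^sub>R y)) (0, r *\<^sub>R h))) (at y)" .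
  have "((\<lambda>v. (x, v)) has_derivative (\<lambda>h. (0, h))) (at y)"
    by (auto intro!: derivative_eq_intros)
  from has_derivative_mult_right[OF has_derivative_compose[OF this frechet_derivative_works[THEN iffD1, OF d(1)]]]
  have "((\<lambda>v. r ^ Suc k * f (x, v)) has_derivative
      (\<lambda>h. r ^ Suc k * frechet_derivative f (at (x, y)) (0, h))) (at y)" .
  then have "((\<lambda>v. f (x, r *\<^sub>R v)) has_derivative
      (\<lambda>h. r ^ Suc k * frechet_derivative f (at (x, y)) (0, h))) (at y)"
    by (rule has_derivative_transform_within_open[of _ _ _ _ "- {0}"]) (use y hom in auto)
  from has_derivative_unique[OF 1 this]
  have eq: "frechet_derivative f (at (x, r *\<^sub>R y)) (0, r *\<^sub>R axis m 1)
      = r ^ Suc k * frechet_derivative f (at (x, y)) (0, axis m 1)" by (rule fun_cong)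
  have "frechet_derivative f (at (x, r *\<^sub>R y)) (0, r *\<^sub>R axis m 1) = r * pdy m f (x, r *\<^sub>R y)"
    using linear_cmul[OF linear_frechet_derivative[OF d(2)], of r "(0, axis m 1)"] by (simp add: pdy_def)
  with eq r show ?thesis by (simp add: pdy_def)
qed

lemma ricci_coord_cong:
  assumes U: "open U" "z \<in> U" and eq: "\<And>u. u \<in> U \<Longrightarrow> H u = H' u"
  shows "ricci_coord H z = ricci_coord H' z"
proof -
  have D: "frechet_derivative (\<lambda>u. H u $ i) (at u) = frechet_derivative (\<lambda>u. H' u $ i) (at u)" if "u \<in> U" for u i
    by (rule frechet_derivative_cong_open[OF U(1) that]) (simp add: eq)
  have 1: "pdy k (\<lambda>u. H u $ i) u = pdy k (\<lambda>u. H' u $ i) u" if "u \<in> U" for u i k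
    by (simp add: pdy_def D[OF that])
  have 2: "frechet_derivative (pdy k (\<lambda>u. H u $ i)) (at z) = frechet_derivative (pdy k (\<lambda>u. H' u $ i)) (at z)" for i k
    by (rule frechet_derivative_cong_open[OF U]) (rule 1)
  have "riemann_coord H i k z = riemann_coord H' i k z" for i k
    unfolding riemann_coord_def 1[OF U(2)] pdx_def pdy_def[of _ "pdy _ _"] D[OF U(2)] 2 eq[OF U(2)] ..
  then show ?thesis by (simp add: ricci_coord_def)
qed

lemma Ck_on_S_coord:
  assumes V: "open V" and X: "Ck_on (Suc k) (V \<times> (- {0})) X"
    and \<sigma>: "Ck_on (Suc k) V \<sigma>" "\<And>x. x \<in> V \<Longrightarrow> \<sigma> x > 0"
  shows "Ck_on k (V \<times> (- {0})) (S_coord X \<sigma>)"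
proof -
  let ?U = "V \<times> (- {0 :: real^'n})"
  have U: "open ?U" by (intro open_Times V) auto
  have ln: "Ck_on k V (pd m (\<lambda>x. ln (\<sigma> x)))" for m
    unfolding pd_def[abs_def] by (rule Ck_on_SucD[OF Ck_on_ln[OF V \<sigma>]])
  have "Ck_on k ?U (\<lambda>z. pd m (\<lambda>x. ln (\<sigma> x)) (fst z))" for m
    by (rule Ck_on_precompose_linear[OF V U bounded_linear_fst _ ln]) auto
  moreover have "Ck_on k ?U (\<lambda>z. snd z $ m)" for m
    by (rule Ck_on_bounded_linear)
      (rule bounded_linear_compose[OF bounded_linear_vec_nth bounded_linear_snd])
  moreover have "Ck_on k ?U (pdy m (\<lambda>u. X u $ m))" for m
    by (rule Ck_on_pdy[OF Ck_on_compose_linear[OF U bounded_linear_vec_nth X]])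
  ultimately show ?thesis unfolding S_coord_def[abs_def]
    by (intro Ck_on_diff Ck_on_sum Ck_on_mult U finite)
qed

text \<open>The S-curvature is homogeneous of degree one, since the vertical derivatives of the
  coefficients are; so Euler's identities hold and \<open>ricci_coord_projective_change\<close> applies.\<close>

lemma ricci_coord_projective_spray:
  fixes X :: "(real^'n) \<times> (real^'n) \<Rightarrow> real^'n"
  defines "P \<equiv> \<lambda>\<sigma> u. S_coord X \<sigma> u / (real CARD('n) + 1)"
  assumes V: "open V" and X: "Ck_on 3 (V \<times> (- {0})) X"
    and hom: "\<And>x y r. x \<in> V \<Longrightarrow> y \<noteq> 0 \<Longrightarrow> r > 0 \<Longrightarrow> X (x, r *\<^sub>R y) = r\<^sup>2 *\<^sub>R X (x, y)"
    and \<sigma>: "Ck_on 3 V \<sigma>" "\<And>x. x \<in> V \<Longrightarrow> \<sigma> x > 0"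
    and z: "z \<in> V \<times> (- {0})"
  shows "ricci_coord (\<lambda>u. X u - P \<sigma> u *\<^sub>R snd u) z = ricci_coord X z + (real CARD('n) - 1) *
    (frechet_derivative (P \<sigma>) (at z) (snd z, - 2 *\<^sub>R X z) + (P \<sigma> z)\<^sup>2)"
proof -
  let ?U = "V \<times> (- {0 :: real^'n})" and ?n = "real CARD('n)"
  have U: "open ?U" by (intro open_Times V) auto
  have three: "(3 :: nat) = Suc 2" by simp
  define N where "N = (\<lambda>u. \<Sum>m\<in>UNIV. pdy m (\<lambda>u. X u $ m) u)"
  define \<omega> where "\<omega> = (\<lambda>z. \<Sum>m\<in>UNIV. snd z $ m * pd m (\<lambda>x. ln (\<sigma> x)) (fst z))"
  have S: "S_coord X \<sigma> u = N u - \<omega> u" for u by (simp add: S_coord_def N_def \<omega>_def)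
  have CS: "Ck_on 2 ?U (S_coord X \<sigma>)"
    using Ck_on_S_coord[OF V] X \<sigma> unfolding three by blast
  have CP: "Ck_on 2 ?U (P \<sigma>)"
    using Ck_on_cmult[OF U CS, of "inverse (?n + 1)"] unfolding P_def by (simp add: divide_inverse mult.commute)
  have Ci: "Ck_on (Suc 2) ?U (\<lambda>u. X u $ i)" for i
    using Ck_on_compose_linear[OF U bounded_linear_vec_nth X] unfolding three .
  have Ci2: "Ck_on 2 ?U (\<lambda>u. X u $ i)" for i by (rule Ck_on_Suc_imp[OF Ci])
  have CN: "Ck_on 2 ?U N" unfolding N_def by (intro Ck_on_sum U finite Ck_on_pdy Ci)
  have diff: "f differentiable (at u)" if "Ck_on 2 ?U f" "u \<in> ?U" for f :: "(real^'n) \<times> (real^'n) \<Rightarrow> real" and u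
    by (rule Ck_on_differentiable[OF that(1) _ that(2)]) simp
  have N_hom: "N (x, r *\<^sub>R y) = r ^ 1 * N (x, y)" if "x \<in> V" "y \<noteq> 0" "r > 0" for x y r
  proof -
    have "pdy m (\<lambda>u. X u $ m) (x, r *\<^sub>R y) = r ^ 1 * pdy m (\<lambda>u. X u $ m) (x, y)" for m
    proof (rule pdy_homogeneous)
      show "(\<lambda>u. X u $ m) differentiable (at (x, y))" "(\<lambda>u. X u $ m) differentiable (at (x, r *\<^sub>R y))"
        using that by (intro diff[OF Ci2]; simp)+
      show "X (x, r *\<^sub>R v) $ m = r ^ Suc 1 * X (x, v) $ m" if "v \<noteq> 0" for v
        using hom[OF \<open>x \<in> V\<close> that \<open>r > 0\<close>] by (simp add: power2_eq_square)
    qed fact+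
    then show ?thesis by (simp add: N_def sum_distrib_left)
  qed
  have P_hom: "P \<sigma> (x, r *\<^sub>R y) = r ^ 1 * P \<sigma> (x, y)" if "x \<in> V" "y \<noteq> 0" "r > 0" for x y r
    using N_hom[OF that] by (simp add: P_def S \<omega>_def sum_distrib_left algebra_simps diff_divide_distrib)
  obtain x y where xy: "z = (x, y)" "x \<in> V" "y \<noteq> 0" using z by auto
  have eulerX: "(\<Sum>s\<in>UNIV. snd z $ s * pdy s (\<lambda>u. X u $ i) z) = 2 * X z $ i" for i
    using euler_pdy[OF diff[OF Ci2], of x y i 2] hom xy by simp
  have eulerN: "(\<Sum>s\<in>UNIV. snd z $ s * pdy s N z) = N z"
    using euler_pdy[OF diff[OF CN], of x y 1] N_hom xy by simp
  have eulerP: "(\<Sum>s\<in>UNIV. snd u $ s * pdy s (P \<sigma>) u) = P \<sigma> u" if "u \<in> ?U" for u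
    using euler_pdy[OF diff[OF CP], of "fst u" "snd u" 1] P_hom[of "fst u" "snd u"] that by (cases u) simp
  have "ricci_coord (\<lambda>u. X u - P \<sigma> u *\<^sub>R snd u) z = ricci_coord X z + (?n - 1) *
    ((\<Sum>j\<in>UNIV. snd z $ j * pdx j (P \<sigma>) z) - 2 * (\<Sum>j\<in>UNIV. X z $ j * pdy j (P \<sigma>) z) + (P \<sigma> z)\<^sup>2)"
    by (rule ricci_coord_projective_change[OF U z Ci2 CP eulerX eulerP eulerN[unfolded N_def]])
  also have "(\<Sum>j\<in>UNIV. snd z $ j * pdx j (P \<sigma>) z) - 2 * (\<Sum>j\<in>UNIV. X z $ j * pdy j (P \<sigma>) z)
     = frechet_derivative (P \<sigma>) (at z) (snd z, - 2 *\<^sub>R X z)"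
    unfolding frechet_derivative_eq_sum_pdx_pdy[OF diff[OF CP z]]
    by (simp add: sum_distrib_left sum_negf mult.assoc)
  finally show ?thesis .
qed

section \<open>A Riccati inequality\<close>

text \<open>As long as \<open>f\<close> is negative, \<open>1/f(t) - t\<close> does not decrease.  Since \<open>f\<close> decreases, it stays
  negative once it is, and \<open>1/f\<close> would reach zero in finite time.\<close>

lemma riccati_no_negative_value:
  fixes f :: "real \<Rightarrow> real"
  assumes f: "\<And>t. (f has_real_derivative D t) (at t)" and D: "\<And>t. D t \<le> - (f t)\<^sup>2"
  shows "f t0 \<ge> 0"
proof (rule ccontr)
  assume "\<not> f t0 \<ge> 0"
  then have neg0: "f t0 < 0" by simp
  have neg: "f t < 0" if "t0 \<le> t" for t
  proof -
    have "f t \<le> f t0"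
    proof (rule DERIV_nonpos_imp_nonincreasing[OF that])
      fix s
      have "D s \<le> 0" using D[of s] zero_le_power2[of "f s"] by linarith
      then show "\<exists>y. DERIV f s :> y \<and> y \<le> 0" using f by blast
    qed
    then show ?thesis using neg0 by simp
  qed
  \<comment> \<open>the time at which the solution of \<open>f' = - f\<^sup>2\<close> with the value \<open>f t0\<close> at \<open>t0\<close> blows up\<close>
  define t1 where "t1 = t0 - inverse (f t0)"
  have le: "t0 \<le> t1" using neg0 by (simp add: t1_def)
  have "inverse (f t0) - t0 \<le> inverse (f t1) - t1"
  proof (rule DERIV_nonneg_imp_nondecreasing[OF le])
    fix s assume s: "t0 \<le> s" "s \<le> t1"
    then have n: "f s \<noteq> 0" using neg[of s] by simp
    have der: "DERIV (\<lambda>t. inverse (f t) - t) s :> - (inverse (f s) * D s * inverse (f s)) - 1"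
      by (intro DERIV_diff DERIV_inverse' f n DERIV_ident)
    have "(f s)\<^sup>2 * inverse ((f s)\<^sup>2) \<le> - D s * inverse ((f s)\<^sup>2)"
      using D[of s] by (intro mult_right_mono) auto
    then have "0 \<le> - (inverse (f s) * D s * inverse (f s)) - 1"
      using n by (simp add: power2_eq_square mult_ac)
    with der show "\<exists>y. DERIV (\<lambda>t. inverse (f t) - t) s :> y \<and> 0 \<le> y" by blast
  qed
  then have "inverse (f t1) \<ge> 0" by (simp add: t1_def)
  with neg[OF le] show False by simp
qed

text \<open>The hypotheses are invariant under replacing \<open>f(t)\<close> by \<open>- f(- t)\<close>.\<close>

lemma riccati_global_solution_zero:
  fixes f :: "real \<Rightarrow> real"
  assumes f: "\<And>t. (f has_real_derivative D t) (at t)" and D: "\<And>t. D t \<le> - (f t)\<^sup>2"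
  shows "f t = 0"
proof -
  have "((\<lambda>t. - f (- t)) has_real_derivative D (- t)) (at t)" for t
  proof -
    have "((\<lambda>t. f (- t)) has_real_derivative D (- t) * (-1)) (at t)"
      by (rule DERIV_chain2[OF f]) (auto intro!: derivative_eq_intros)
    from DERIV_minus[OF this] show ?thesis by simp
  qed
  then have "- f (- (- t)) \<ge> 0"
    by (rule riccati_no_negative_value) (use D in simp)
  moreover have "f t \<ge> 0" by (rule riccati_no_negative_value[OF f D])
  ultimately show ?thesis by simp
qed

section \<open>Local existence of integral curves in Euclidean space\<close>

lemma C1_lipschitz_on_cball:
  fixes F :: "'e::euclidean_space \<Rightarrow> 'b::euclidean_space"
  assumes "cball z r \<subseteq> S" "Ck_on 1 S F"
  obtains L where "L \<ge> 0" "\<And>x y. x \<in> cball z r \<Longrightarrow> y \<in> cball z r \<Longrightarrow> norm (F x - F y) \<le> L * norm (x - y)"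
proof -
  let ?D = "\<lambda>x. frechet_derivative F (at x)"
  have C: "Ck_on (Suc 0) S F" using assms(2) by simp
  have "\<exists>K. \<forall>x\<in>cball z r. norm (?D x b) \<le> K" for b
  proof -
    have "continuous_on (cball z r) (\<lambda>x. ?D x b)"
      using C assms(1) by (auto intro: continuous_on_subset)
    from compact_continuous_image[OF this compact_cball] have "bounded ((\<lambda>x. ?D x b) ` cball z r)"
      by (rule compact_imp_bounded)
    then show ?thesis unfolding bounded_iff by auto
  qed
  then obtain K where K: "\<And>b x. x \<in> cball z r \<Longrightarrow> norm (?D x b) \<le> K b" by metis
  define L where "L = (\<Sum>b\<in>Basis. \<bar>K b\<bar>)"
  have "norm (F x - F y) \<le> L * norm (x - y)" if "x \<in> cball z r" "y \<in> cball z r" for x y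
  proof (rule differentiable_bound[OF convex_cball _ _ that])
    fix x assume x: "x \<in> cball z r"
    have der: "(F has_derivative ?D x) (at x)"
      using Ck_on_has_derivative[OF C] assms(1) x by blast
    then show "(F has_derivative ?D x) (at x within cball z r)"
      by (rule has_derivative_at_withinI)
    have lin: "linear (?D x)" by (rule has_derivative_linear[OF der])
    show "onorm (?D x) \<le> L"
    proof (rule onorm_bound)
      show "0 \<le> L" by (simp add: L_def sum_nonneg)
      fix v :: 'e
      have "?D x v = ?D x (\<Sum>b\<in>Basis. (v \<bullet> b) *\<^sub>R b)" by (simp add: euclidean_representation)
      also have "\<dots> = (\<Sum>b\<in>Basis. (v \<bullet> b) *\<^sub>R ?D x b)"
        by (simp add: linear_sum[OF lin] linear_cmul[OF lin])
      also have "norm \<dots> \<le> (\<Sum>b\<in>Basis. \<bar>K b\<bar> * norm v)"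
      proof (rule sum_norm_le)
        fix b :: 'e assume b: "b \<in> Basis"
        have "norm ((v \<bullet> b) *\<^sub>R ?D x b) = \<bar>v \<bullet> b\<bar> * norm (?D x b)" by simp
        also have "\<dots> \<le> norm v * \<bar>K b\<bar>"
          using K[OF x, of b] Basis_le_norm[OF b, of v] by (intro mult_mono) auto
        finally show "norm ((v \<bullet> b) *\<^sub>R ?D x b) \<le> \<bar>K b\<bar> * norm v" by (simp add: mult.commute)
      qed
      finally show "norm (?D x v) \<le> L * norm v" by (simp add: L_def sum_distrib_right)
    qed
  qed
  moreover have "L \<ge> 0" by (simp add: L_def sum_nonneg)
  ultimately show ?thesis using that by blast
qed

text \<open>The primitive vanishing at \<open>0\<close>, extended by constants outside \<open>[-a, a]\<close>: this makes the Picard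
  operator act on bounded functions defined on the whole line.\<close>

definition clamped_primitive :: "real \<Rightarrow> (real \<Rightarrow> 'e::euclidean_space) \<Rightarrow> real \<Rightarrow> 'e" where
  "clamped_primitive a g t = integral {-a..max (-a) (min a t)} g - integral {-a..0} g"

lemma clamped_primitive_0: "a > 0 \<Longrightarrow> clamped_primitive a g 0 = 0"
  by (simp add: clamped_primitive_def)

lemma clamped_primitive_bound:
  assumes a: "a > 0" and g: "continuous_on UNIV g" and B: "\<And>s. norm (g s) \<le> B"
  shows "norm (clamped_primitive a g t) \<le> 3 * a * B"
proof -
  have c: "continuous_on T g" for T using g continuous_on_subset by blast
  define m where "m = max (-a) (min a t)"
  have m: "-a \<le> m" "m \<le> a" using a by (auto simp: m_def)
  have B0: "B \<ge> 0" using B[of 0] norm_ge_zero[of "g 0"] by linarith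
  have "norm (integral {-a..m} g) \<le> B * (m - (-a))"
    by (rule integral_bound) (use m c B in auto)
  also have "\<dots> \<le> B * (2 * a)" using m B0 by (intro mult_left_mono) auto
  finally have 1: "norm (integral {-a..m} g) \<le> B * (2 * a)" .
  have 2: "norm (integral {-a..0} g) \<le> B * (0 - (-a))"
    by (rule integral_bound) (use a c B in auto)
  have "norm (clamped_primitive a g t) \<le> norm (integral {-a..m} g) + norm (integral {-a..0} g)"
    unfolding clamped_primitive_def m_def[symmetric] by (rule norm_triangle_ineq4)
  also have "\<dots> \<le> B * (2 * a) + B * (0 - (-a))" by (rule add_mono[OF 1 2])
  finally show ?thesis by (simp add: algebra_simps)
qed

lemma clamped_primitive_diff:
  assumes "continuous_on UNIV g" "continuous_on UNIV h"
  shows "clamped_primitive a g t - clamped_primitive a h t = clamped_primitive a (\<lambda>s. g s - h s) t"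
proof -
  have "g integrable_on {l..u}" "h integrable_on {l..u}" for l u
    using assms by (auto intro!: integrable_continuous_real intro: continuous_on_subset)
  then show ?thesis by (simp add: clamped_primitive_def integral_diff)
qed

lemma clamped_primitive_continuous:
  assumes a: "a > 0" and g: "continuous_on UNIV g"
  shows "continuous_on UNIV (clamped_primitive a g)"
proof -
  have "g integrable_on {-a..a}"
    using g by (auto intro!: integrable_continuous_real intro: continuous_on_subset)
  then have "continuous_on {-a..a} (\<lambda>x. integral {-a..x} g)" by (rule indefinite_integral_continuous_1)
  then have "continuous_on UNIV (\<lambda>t. integral {-a..max (-a) (min a t)} g)"
    by (rule continuous_on_compose2[where f = "\<lambda>t. max (-a) (min a t)"])
      (use a in \<open>auto intro!: continuous_intros\<close>)
  then show ?thesis unfolding clamped_primitive_def[abs_def] by (intro continuous_intros)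
qed

lemma clamped_primitive_derivative:
  assumes t: "-a < t" "t < a" and g: "continuous_on UNIV g"
  shows "(clamped_primitive a g has_vector_derivative g t) (at t)"
proof -
  have "continuous_on {-a..a} g" using g continuous_on_subset by blast
  then have "((\<lambda>x. integral {-a..x} g) has_vector_derivative g t) (at t within {-a..a})"
    by (rule integral_has_vector_derivative) (use t in auto)
  then have "((\<lambda>x. integral {-a..x} g) has_vector_derivative g t) (at t within {-a<..<a})"
    by (rule has_vector_derivative_within_subset) auto
  then have "((\<lambda>x. integral {-a..x} g) has_vector_derivative g t) (at t)"
    using t by (simp add: at_within_open[of t "{-a<..<a}"])
  then have "((\<lambda>x. integral {-a..x} g - integral {-a..0} g) has_vector_derivative g t - 0) (at t)"
    by (intro has_vector_derivative_diff has_vector_derivative_const)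
  then have "((\<lambda>x. integral {-a..x} g - integral {-a..0} g) has_vector_derivative g t) (at t)" by simp
  then show ?thesis
    by (rule has_vector_derivative_transform_within_open[of _ _ _ "{-a<..<a}"])
       (use t in \<open>auto simp: clamped_primitive_def max_def min_def\<close>)
qed

text \<open>The Picard-Lindelof theorem.  Composing \<open>F\<close> with the projection onto a small closed ball makes it
  bounded and globally Lipschitz, so that the contraction principle applies on a complete space;
  for short times the fixed point does not leave the ball.\<close>

lemma local_solution_exists:
  fixes F :: "'e::euclidean_space \<Rightarrow> 'e"
  assumes S: "open S" "z \<in> S" and F: "Ck_on 1 S F"
  obtains a u where "a > 0" "u 0 = z" 
    "\<And>t. -a < t \<Longrightarrow> t < a \<Longrightarrow> u t \<in> S \<and> (u has_vector_derivative F (u t)) (at t)"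
proof -
  obtain r where r: "r > 0" "cball z r \<subseteq> S" using S open_contains_cball by blast
  obtain L where L: "L \<ge> 0" "\<And>x y. x \<in> cball z r \<Longrightarrow> y \<in> cball z r \<Longrightarrow> norm (F x - F y) \<le> L * norm (x - y)"
    using C1_lipschitz_on_cball[OF r(2) F] by blast
  have "continuous_on S F" using Ck_on_le[OF F, of 0] by simp
  then have contF: "continuous_on (cball z r) F" using r(2) continuous_on_subset by blast
  from compact_imp_bounded[OF compact_continuous_image[OF this compact_cball]]
  obtain M where "\<forall>x\<in>F ` cball z r. norm x \<le> M" unfolding bounded_iff by blast
  then have M: "norm (F x) \<le> M" if "x \<in> cball z r" for x using that by blast
  have M0: "M \<ge> 0" using order_trans[OF norm_ge_zero M[of z]] r(1) by simp
  define p where "p = closest_point (cball z r)"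
  have ne: "cball z r \<noteq> {}" using r by auto
  have p: "p x \<in> cball z r" for x unfolding p_def using ne by (intro closest_point_in_set) auto
  have p_id: "p x = x" if "x \<in> cball z r" for x unfolding p_def by (rule closest_point_self[OF that])
  have plip: "norm (p x - p y) \<le> norm (x - y)" for x y
    using closest_point_lipschitz[OF convex_cball closed_cball ne] unfolding p_def dist_norm .
  have Flip: "norm (F (p x) - F (p y)) \<le> L * norm (x - y)" for x y
  proof -
    have "norm (F (p x) - F (p y)) \<le> L * norm (p x - p y)" by (rule L(2)[OF p p])
    also have "\<dots> \<le> L * norm (x - y)" by (rule mult_left_mono[OF plip L(1)])
    finally show ?thesis .
  qed
  have "continuous_on UNIV p" unfolding p_def
    by (rule continuous_on_closest_point) (use ne in auto)
  then have contFp: "continuous_on UNIV (\<lambda>x. F (p x))"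
    using continuous_on_compose2[OF contF] p by blast
  \<comment> \<open>by \<open>clamped_primitive_bound\<close> the Picard operator contracts with the factor \<open>3 a L\<close> and moves
     points by at most \<open>3 a M\<close>\<close>
  define a where "a = min (1 / (6 * (L + 1))) (r / (3 * (M + 1)))"
  have a: "a > 0" using L(1) M0 r(1) by (simp add: a_def)
  have aL: "3 * a * L \<le> 1 / 2"
  proof -
    have "3 * a * L \<le> 3 * (1 / (6 * (L + 1))) * (L + 1)"
      using L(1) a by (intro mult_mono) (auto simp: a_def)
    also have "\<dots> = 1 / 2" using L(1) by (simp add: divide_simps)
    finally show ?thesis .
  qed
  have aM: "3 * a * M \<le> r"
  proof -
    have "3 * a * M \<le> 3 * (r / (3 * (M + 1))) * (M + 1)"
      using M0 a r(1) by (intro mult_mono) (auto simp: a_def)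
    also have "\<dots> = r" using M0 by (simp add: divide_simps)
    finally show ?thesis .
  qed
  define T where "T u t = z + clamped_primitive a (\<lambda>s. F (p (apply_bcontfun u s))) t"
    for u :: "real \<Rightarrow>\<^sub>C 'e" and t
  have contu: "continuous_on UNIV (\<lambda>s. F (p (apply_bcontfun u s)))" for u :: "real \<Rightarrow>\<^sub>C 'e"
    by (rule continuous_on_compose2[OF contFp continuous_on_apply_bcontfun]) simp
  have Tbound: "norm (T u t - z) \<le> 3 * a * M" for u t
    unfolding T_def using clamped_primitive_bound[OF a contu, of u M t] M[OF p] by simp
  have T: "T u \<in> bcontfun" for u
  proof (rule bcontfun_normI)
    show "continuous_on UNIV (T u)" unfolding T_def[abs_def]
      by (intro continuous_intros clamped_primitive_continuous a contu)
    show "norm (T u t) \<le> norm z + 3 * a * M" for t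
      using norm_triangle_sub[of "T u t" z] Tbound[of u t] by linarith
  qed
  have "\<exists>!u. Bcontfun (T u) = u"
  proof (rule banach_fix_type[of "1/2"])
    have "dist (T u t) (T v t) \<le> 1/2 * dist u v" for u v t
    proof -
      have "T u t - T v t = clamped_primitive a
          (\<lambda>s. F (p (apply_bcontfun u s)) - F (p (apply_bcontfun v s))) t"
        unfolding T_def using clamped_primitive_diff[OF contu contu, of a u t v] by simp
      also have "norm \<dots> \<le> 3 * a * (L * dist u v)"
      proof (rule clamped_primitive_bound[OF a])
        show "continuous_on UNIV (\<lambda>s. F (p (apply_bcontfun u s)) - F (p (apply_bcontfun v s)))"
          by (intro continuous_on_diff contu)
        show "norm (F (p (apply_bcontfun u s)) - F (p (apply_bcontfun v s))) \<le> L * dist u v" for s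
          using Flip[of "apply_bcontfun u s" "apply_bcontfun v s"]
            mult_left_mono[OF dist_bounded[of u s v] L(1)] by (simp add: dist_norm)
      qed
      also have "\<dots> = (3 * a * L) * dist u v" by simp
      also have "\<dots> \<le> 1/2 * dist u v" by (rule mult_right_mono[OF aL]) simp
      finally show ?thesis by (simp add: dist_norm)
    qed
    then show "\<forall>u v. dist (Bcontfun (T u)) (Bcontfun (T v)) \<le> 1/2 * dist u v"
      by (intro allI dist_bound) (simp add: Bcontfun_inverse[OF T])
  qed auto
  then obtain v where "Bcontfun (T v) = v" by blast
  then have v: "apply_bcontfun v = T v" using Bcontfun_inverse[OF T, of v] by simp
  define u where "u = apply_bcontfun v"
  have u: "u t = z + clamped_primitive a (\<lambda>s. F (p (u s))) t" for t
    using fun_cong[OF v, of t] unfolding u_def T_def .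
  have ball: "u t \<in> cball z r" for t
    using Tbound[of v t] aM unfolding u_def v by (simp add: dist_norm norm_minus_commute)
  have contFu: "continuous_on UNIV (\<lambda>s. F (u s))" using contu[of v] p_id[OF ball] unfolding u_def by simp
  have u': "u = (\<lambda>t. z + clamped_primitive a (\<lambda>s. F (u s)) t)"
  proof (rule ext)
    fix t
    have "(\<lambda>s. F (p (u s))) = (\<lambda>s. F (u s))" by (simp add: p_id[OF ball])
    then show "u t = z + clamped_primitive a (\<lambda>s. F (u s)) t" using u[of t] by argo
  qed
  show ?thesis
  proof (rule that[OF a])
    show "u 0 = z" by (subst u) (simp add: clamped_primitive_0[OF a])
    fix t assume t: "-a < t" "t < a"
    have "((\<lambda>t. z + clamped_primitive a (\<lambda>s. F (u s)) t) has_vector_derivative 0 + F (u t)) (at t)"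
      by (intro has_vector_derivative_add has_vector_derivative_const clamped_primitive_derivative t contFu)
    then have "(u has_vector_derivative F (u t)) (at t)" unfolding u'[symmetric] by simp
    then show "u t \<in> S \<and> (u has_vector_derivative F (u t)) (at t)" using ball r(2) by blast
  qed
qed

section \<open>Charts of the slit tangent bundle\<close>

text \<open>The map \<open>(x, y) \<mapsto> D\<tau>(x) y\<close> is a linear combination of the partial derivatives of \<open>\<tau>\<close> with
  the components of \<open>y\<close> as coefficients, which reduces its differentiability in both arguments to
  that of directional derivatives in fixed directions.  Symmetry of the second derivative makes
  \<open>D\<^sup>2\<tau>(y, \<cdot>)\<close> linear in \<open>y\<close>.\<close>

lemma tangent_map_has_derivative:
  fixes \<tau> :: "real^'n \<Rightarrow> real^'n"
  defines "J \<equiv> \<lambda>u. frechet_derivative \<tau> (at u)"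
  assumes U: "open U" "x \<in> U" and \<tau>: "Ck_on 2 U \<tau>"
  shows "((\<lambda>z. (\<tau> (fst z), J (fst z) (snd z))) has_derivative
     (\<lambda>h. (J x (fst h), frechet_derivative (\<lambda>u. J u y) (at x) (fst h) + J x (snd h)))) (at (x, y))"
proof -
  have C1: "Ck_on (Suc (Suc 0)) U \<tau>" using \<tau> by (simp add: numeral_2_eq_2)
  have J: "(\<tau> has_derivative J u) (at u)" if "u \<in> U" for u
    unfolding J_def by (rule Ck_on_has_derivative[OF C1 that])
  have linJ: "linear (J u)" if "u \<in> U" for u using J[OF that] by (rule has_derivative_linear)
  define B where "B v = frechet_derivative (\<lambda>u. J u v) (at x)" for v
  have B: "((\<lambda>u. J u v) has_derivative B v) (at x)" for v
    using Ck_on_has_derivative[OF Ck_on_SucD[OF C1] U(2)] unfolding B_def J_def .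
  have sym: "B v w = B w v" for v w
    unfolding B_def J_def by (rule second_derivative_symmetric[OF U \<tau>])
  have linB: "linear (\<lambda>v. B v w)" for w using has_derivative_linear[OF B, of w] by (simp add: sym[of _ w])
  have fst': "(fst has_derivative fst) (at (x, y))" and snd': "((\<lambda>z. snd z $ i) has_derivative (\<lambda>h. snd h $ i)) (at (x, y))" for i
    by (rule bounded_linear_imp_has_derivative,
        rule bounded_linear_fst bounded_linear_compose[OF bounded_linear_vec_nth bounded_linear_snd])+
  have a: "((\<lambda>z. \<tau> (fst z)) has_derivative (\<lambda>h. J x (fst h))) (at (x, y))"
    by (rule has_derivative_compose[OF fst']) (simp add: J[OF U(2)])
  have Bi: "((\<lambda>z. J (fst z) (axis i 1)) has_derivative (\<lambda>h. B (axis i 1) (fst h))) (at (x, y))" for i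
    by (rule has_derivative_compose[OF fst']) (simp add: B)
  have "((\<lambda>z. \<Sum>i\<in>UNIV. snd z $ i *\<^sub>R J (fst z) (axis i 1)) has_derivative
     (\<lambda>h. \<Sum>i\<in>UNIV. snd (x, y) $ i *\<^sub>R B (axis i 1) (fst h) + snd h $ i *\<^sub>R J (fst (x, y)) (axis i 1))) (at (x, y))"
    by (intro has_derivative_sum has_derivative_scaleR snd' Bi)
  also have "(\<lambda>h. \<Sum>i\<in>UNIV. snd (x, y) $ i *\<^sub>R B (axis i 1) (fst h) + snd h $ i *\<^sub>R J (fst (x, y)) (axis i 1))
      = (\<lambda>h. B y (fst h) + J x (snd h))"
  proof (rule ext)
    fix h :: "(real^'n) \<times> (real^'n)"
    show "(\<Sum>i\<in>UNIV. snd (x, y) $ i *\<^sub>R B (axis i 1) (fst h) + snd h $ i *\<^sub>R J (fst (x, y)) (axis i 1))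
      = B y (fst h) + J x (snd h)"
      unfolding sum.distrib fst_conv snd_conv
      by (rule arg_cong2[where f = "(+)"]; rule linear_eq_sum_axis[symmetric, OF linB]
           linear_eq_sum_axis[symmetric, OF linJ[OF U(2)]])
  qed
  finally have "((\<lambda>z. J (fst z) (snd z)) has_derivative (\<lambda>h. B y (fst h) + J x (snd h))) (at (x, y))"
  proof (rule has_derivative_transform_within_open[of _ _ _ _ "fst -` U"])
    show "open (fst -` U :: ((real^'n) \<times> (real^'n)) set)" by (rule open_vimage_fst[OF U(1)])
    show "(\<Sum>i\<in>UNIV. snd z $ i *\<^sub>R J (fst z) (axis i 1)) = J (fst z) (snd z)" if "z \<in> fst -` U" for z
      using linear_eq_sum_axis[OF linJ, of "fst z" "snd z"] that by simp
  qed (use U in simp)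
  from has_derivative_Pair[OF a this] show ?thesis unfolding B_def .
qed

lemma tangent_at_components:
  "tangent_at B p v \<Longrightarrow> c \<in> B \<Longrightarrow> d \<in> B \<Longrightarrow> p \<in> chart_dom c \<Longrightarrow> p \<in> chart_dom d \<Longrightarrow>
    v d = frechet_derivative (transition c d) (at (chart_map c p)) (v c)"
  unfolding tangent_at_def by blast

locale smooth_manifold =
  fixes A :: "('m::{t2_space,second_countable_topology}, real^'n) chart set"
  assumes smooth_structure: "smooth_structure A"
begin

lemma
  shows atlas_topological: "\<forall>c\<in>A. topological_chart c"
    and atlas_cover: "(\<Union>c\<in>A. chart_dom c) = UNIV"
    and atlas_compatible: "\<forall>c\<in>A. \<forall>d\<in>A. smoothly_compatible c d"
  by (rule smooth_structure[unfolded smooth_structure_def, THEN conjunct1]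
        smooth_structure[unfolded smooth_structure_def, THEN conjunct2, THEN conjunct1]
        smooth_structure[unfolded smooth_structure_def, THEN conjunct2, THEN conjunct2, THEN conjunct1])+

lemma
  assumes "c \<in> A"
  shows open_chart_dom: "open (chart_dom c)" and open_chart_img: "open (chart_img c)"
    and chart_inv_map: "\<And>p. p \<in> chart_dom c \<Longrightarrow> chart_inv c (chart_map c p) = p"
    and chart_map_inv: "\<And>x. x \<in> chart_img c \<Longrightarrow> chart_map c (chart_inv c x) = x"
    and chart_inv_dom: "\<And>x. x \<in> chart_img c \<Longrightarrow> chart_inv c x \<in> chart_dom c"
    and continuous_chart_inv: "continuous_on (chart_img c) (chart_inv c)"
proof -
  have "topological_chart c" using atlas_topological assms by blast
  then have t: "open (chart_dom c)" "open (chart_img c)"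
    "homeomorphism (chart_dom c) (chart_img c) (chart_map c) (chart_inv c)"
    by (simp_all add: topological_chart_def)
  show "open (chart_dom c)" "open (chart_img c)" by fact+
  show "chart_inv c (chart_map c p) = p" if "p \<in> chart_dom c" for p
    using t(3) that by (simp add: homeomorphism_def)
  show "chart_map c (chart_inv c x) = x" if "x \<in> chart_img c" for x
    using homeomorphism_apply2[OF t(3) that] .
  show "chart_inv c x \<in> chart_dom c" if "x \<in> chart_img c" for x
    using homeomorphism_image2[OF t(3)] that by blast
  show "continuous_on (chart_img c) (chart_inv c)" by (rule homeomorphism_cont2[OF t(3)])
qed

lemma ex_chart: "\<exists>c. c \<in> A \<and> p \<in> chart_dom c"
  using atlas_cover by blast

lemma chart_at: "chart_at A p \<in> A" "p \<in> chart_dom (chart_at A p)"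
  using someI_ex[OF ex_chart[of p]] unfolding chart_at_def by blast+

definition overlap :: "('m, real^'n) chart \<Rightarrow> ('m, real^'n) chart \<Rightarrow> (real^'n) set" where
  "overlap c d = chart_map c ` (chart_dom c \<inter> chart_dom d)"

lemma overlap_iff: "c \<in> A \<Longrightarrow> x \<in> overlap c d \<longleftrightarrow> x \<in> chart_img c \<and> chart_inv c x \<in> chart_dom d"
  unfolding overlap_def using chart_inv_map chart_map_inv chart_inv_dom by (force simp: image_iff)

lemma overlapI: "p \<in> chart_dom c \<Longrightarrow> p \<in> chart_dom d \<Longrightarrow> chart_map c p \<in> overlap c d"
  by (simp add: overlap_def)

lemma open_overlap: assumes "c \<in> A" "d \<in> A" shows "open (overlap c d)"
proof -
  have "overlap c d = chart_img c \<inter> chart_inv c -` chart_dom d"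
    using overlap_iff[OF assms(1)] by blast
  then show ?thesis
    using continuous_open_preimage[OF continuous_chart_inv open_chart_img open_chart_dom] assms by simp
qed

lemma transition_smooth: "c \<in> A \<Longrightarrow> d \<in> A \<Longrightarrow> Ck_on k (overlap c d) (transition c d)"
  using atlas_compatible unfolding smoothly_compatible_def overlap_def smooth_on_def
  by blast

lemma transition_chart_map: "c \<in> A \<Longrightarrow> p \<in> chart_dom c \<Longrightarrow> transition c d (chart_map c p) = chart_map d p"
  by (simp add: transition_def chart_inv_map)

definition jacobian :: "('m, real^'n) chart \<Rightarrow> ('m, real^'n) chart \<Rightarrow> real^'n \<Rightarrow> real^'n \<Rightarrow> real^'n" where
  "jacobian c d x = frechet_derivative (transition c d) (at x)"

lemma transition_has_derivative:
  assumes "c \<in> A" "d \<in> A" "x \<in> overlap c d"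
  shows "(transition c d has_derivative jacobian c d x) (at x)"
  unfolding jacobian_def by (rule Ck_on_has_derivative[OF transition_smooth[OF assms(1,2), of "Suc 0"] assms(3)])

lemma linear_jacobian: "c \<in> A \<Longrightarrow> d \<in> A \<Longrightarrow> x \<in> overlap c d \<Longrightarrow> linear (jacobian c d x)"
  by (rule has_derivative_linear[OF transition_has_derivative])

lemma jacobian_cocycle:
  assumes A: "c \<in> A" "d \<in> A" "e \<in> A" and p: "p \<in> chart_dom c" "p \<in> chart_dom d" "p \<in> chart_dom e"
  shows "jacobian d e (chart_map d p) (jacobian c d (chart_map c p) v) = jacobian c e (chart_map c p) v"
proof -
  let ?x = "chart_map c p"
  have "(transition d e has_derivative jacobian d e (chart_map d p)) (at (transition c d ?x))"
    using transition_has_derivative[OF A(2,3) overlapI[OF p(2,3)]] transition_chart_map[OF A(1) p(1)] by simp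
  from has_derivative_compose[OF transition_has_derivative[OF A(1,2) overlapI[OF p(1,2)]] this]
  have "((\<lambda>x. transition d e (transition c d x)) has_derivative
      (\<lambda>v. jacobian d e (chart_map d p) (jacobian c d ?x v))) (at ?x)" .
  then have "(transition c e has_derivative
      (\<lambda>v. jacobian d e (chart_map d p) (jacobian c d ?x v))) (at ?x)"
  proof (rule has_derivative_transform_within_open[of _ _ _ _ "overlap c d"])
    show "transition d e (transition c d x) = transition c e x" if "x \<in> overlap c d" for x
      using that overlap_iff[OF A(1)] by (simp add: transition_def chart_inv_map[OF A(2)])
  qed (use open_overlap[OF A(1,2)] overlapI[OF p(1,2)] in simp_all)
  then show ?thesis
    using has_derivative_unique[OF _ transition_has_derivative[OF A(1,3) overlapI[OF p(1,3)]]] by metis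
qed

lemma jacobian_self:
  assumes A: "c \<in> A" and p: "p \<in> chart_dom c"
  shows "jacobian c c (chart_map c p) v = v"
proof -
  have "((\<lambda>x. x) has_derivative (\<lambda>v. v)) (at (chart_map c p))" by (rule has_derivative_ident)
  then have "(transition c c has_derivative (\<lambda>v. v)) (at (chart_map c p))"
  proof (rule has_derivative_transform_within_open[of _ _ _ _ "overlap c c"])
    show "x = transition c c x" if "x \<in> overlap c c" for x
      using that overlap_iff[OF A] by (simp add: transition_def chart_map_inv[OF A])
  qed (use open_overlap[OF A A] overlapI[OF p p] in simp_all)
  then show ?thesis by (simp add: jacobian_def frechet_derivative_eqI)
qed

lemma tangent_at_jacobian:
  "tangent_at A p v \<Longrightarrow> c \<in> A \<Longrightarrow> d \<in> A \<Longrightarrow> p \<in> chart_dom c \<Longrightarrow> p \<in> chart_dom d \<Longrightarrow>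
    v d = jacobian c d (chart_map c p) (v c)"
  unfolding tangent_at_def jacobian_def by blast

definition tangent_vector_in :: "('m, real^'n) chart \<Rightarrow> 'm \<Rightarrow> real^'n \<Rightarrow> ('m, real^'n) components" where
  "tangent_vector_in c p y = (\<lambda>d. if d \<in> A \<and> p \<in> chart_dom d then jacobian c d (chart_map c p) y else 0)"

lemma
  assumes "c \<in> A" "p \<in> chart_dom c"
  shows tangent_at_tangent_vector_in: "tangent_at A p (tangent_vector_in c p y)" and tangent_vector_in_self: "tangent_vector_in c p y c = y"
proof -
  show "tangent_at A p (tangent_vector_in c p y)"
    unfolding tangent_at_def jacobian_def[symmetric] tangent_vector_in_def using assms by (auto simp: jacobian_cocycle)
  show "tangent_vector_in c p y c = y" using assms by (simp add: tangent_vector_in_def jacobian_self)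
qed

lemma tangent_at_eqI:
  assumes "tangent_at A p v" "tangent_at A p w" "c \<in> A" "p \<in> chart_dom c" "v c = w c"
  shows "v = w"
proof
  fix d show "v d = w d"
  proof (cases "d \<in> A \<and> p \<in> chart_dom d")
    case True
    then show ?thesis using tangent_at_jacobian[OF assms(1,3) _ assms(4)]
       tangent_at_jacobian[OF assms(2,3) _ assms(4)] assms(5) by auto
  next
    case False
    then show ?thesis using assms(1,2) unfolding tangent_at_def by auto
  qed
qed

lemma tangent_at_zero: "tangent_at A p (\<lambda>_. 0)"
proof -
  have "jacobian c d (chart_map c p) 0 = 0" if "c \<in> A" "d \<in> A" "p \<in> chart_dom c \<inter> chart_dom d" for c d
    using linear_jacobian[OF that(1,2) overlapI] that(3) by (auto intro: linear_0)
  then show ?thesis unfolding tangent_at_def jacobian_def by auto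
qed

abbreviation "TM \<equiv> slit_tangent_bundle A"
abbreviation "ind \<equiv> induced_chart A"

definition slit_img :: "('m, real^'n) chart \<Rightarrow> ((real^'n) \<times> (real^'n)) set" where
  "slit_img c = chart_img c \<times> (- {0})"

lemma slit_img_iff: "z \<in> slit_img c \<longleftrightarrow> fst z \<in> chart_img c \<and> snd z \<noteq> 0"
  by (simp add: slit_img_def mem_Times_iff)

lemma open_slit_img: "c \<in> A \<Longrightarrow> open (slit_img c)"
  unfolding slit_img_def by (intro open_Times open_chart_img) auto

lemma ind_dom: "w \<in> chart_dom (ind c) \<longleftrightarrow> w \<in> TM \<and> fst w \<in> chart_dom c"
  by (auto simp: induced_chart_def)

lemma ind_map: "chart_map (ind c) w = (chart_map c (fst w), snd w c)"
  by (simp add: induced_chart_def split_beta)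

lemma TM_tangent: "w \<in> TM \<Longrightarrow> tangent_at A (fst w) (snd w)"
  by (auto simp: slit_tangent_bundle_def)

lemma TM_component_nonzero:
  assumes "w \<in> TM" "c \<in> A" "fst w \<in> chart_dom c" shows "snd w c \<noteq> 0"
  using tangent_at_eqI[OF TM_tangent[OF assms(1)] tangent_at_zero assms(2,3)] assms(1)
  by (auto simp: slit_tangent_bundle_def)

lemma ind_map_slit_img: "c \<in> A \<Longrightarrow> w \<in> chart_dom (ind c) \<Longrightarrow> chart_map (ind c) w \<in> slit_img c"
  using TM_component_nonzero by (auto simp: ind_dom ind_map slit_img_def)

lemma ind_inj: assumes "c \<in> A" shows "inj_on (chart_map (ind c)) (chart_dom (ind c))"
proof (rule inj_onI)
  fix w w' assume w: "w \<in> chart_dom (ind c)" and w': "w' \<in> chart_dom (ind c)"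
    and eq: "chart_map (ind c) w = chart_map (ind c) w'"
  have p: "fst w = fst w'"
    using w w' eq chart_inv_map[OF assms] by (metis ind_dom ind_map prod.inject)
  have "tangent_at A (fst w) (snd w)" "tangent_at A (fst w) (snd w')"
    using TM_tangent[of w] TM_tangent[of w'] w w' p by (simp_all add: ind_dom)
  then have "snd w = snd w'"
    by (rule tangent_at_eqI[OF _ _ assms]) (use w eq in \<open>simp_all add: ind_dom ind_map\<close>)
  with p show "w = w'" by (rule prod_eqI)
qed

lemma ind_inv_map: "c \<in> A \<Longrightarrow> w \<in> chart_dom (ind c) \<Longrightarrow> chart_inv (ind c) (chart_map (ind c) w) = w"
  unfolding chart_inv_def by (rule inv_into_f_f[OF ind_inj])

text \<open>Surjectivity onto \<open>slit_img c\<close> holds because every vector of components in one chart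
  extends to a tangent vector, by the cocycle property of the Jacobians.\<close>

lemma ind_img: assumes "c \<in> A" shows "chart_img (ind c) = slit_img c"
proof
  show "chart_img (ind c) \<subseteq> slit_img c" using ind_map_slit_img[OF assms] by blast
  show "slit_img c \<subseteq> chart_img (ind c)"
  proof
    fix z assume z: "z \<in> slit_img c"
    define p where "p = chart_inv c (fst z)"
    have p: "p \<in> chart_dom c" "chart_map c p = fst z"
      using z chart_inv_dom[OF assms] chart_map_inv[OF assms] by (auto simp: p_def slit_img_def)
    let ?w = "(p, tangent_vector_in c p (snd z))"
    have "tangent_vector_in c p (snd z) \<noteq> (\<lambda>_. 0)"
      using tangent_vector_in_self[OF assms p(1), of "snd z"] z by (auto simp: slit_img_def fun_eq_iff)
    then have "?w \<in> chart_dom (ind c)"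
      using p tangent_at_tangent_vector_in[OF assms p(1)] by (simp add: ind_dom slit_tangent_bundle_def)
    moreover have "chart_map (ind c) ?w = z"
      by (simp add: ind_map p tangent_vector_in_self[OF assms p(1)])
    ultimately show "z \<in> chart_img (ind c)" by (metis imageI)
  qed
qed

lemma ind_inv: assumes "c \<in> A" "z \<in> slit_img c"
  shows ind_inv_dom: "chart_inv (ind c) z \<in> chart_dom (ind c)"
    and ind_map_inv: "chart_map (ind c) (chart_inv (ind c) z) = z"
    and fst_ind_inv: "fst (chart_inv (ind c) z) = chart_inv c (fst z)"
proof -
  have z: "z \<in> chart_img (ind c)" using assms ind_img by blast
  show d: "chart_inv (ind c) z \<in> chart_dom (ind c)" unfolding chart_inv_def by (rule inv_into_into[OF z])
  show m: "chart_map (ind c) (chart_inv (ind c) z) = z" unfolding chart_inv_def by (rule f_inv_into_f[OF z])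
  have "chart_map c (fst (chart_inv (ind c) z)) = fst z" using m by (metis fst_conv ind_map)
  then show "fst (chart_inv (ind c) z) = chart_inv c (fst z)"
    using chart_inv_map[OF assms(1), of "fst (chart_inv (ind c) z)"] d by (simp add: ind_dom)
qed

lemma ind_transition:
  assumes "c \<in> A" "d \<in> A" "fst z \<in> overlap c d" "snd z \<noteq> 0"
  shows "transition (ind c) (ind d) z = (transition c d (fst z), jacobian c d (fst z) (snd z))"
    and "chart_inv (ind c) z \<in> chart_dom (ind d)"
proof -
  have z: "z \<in> slit_img c" using assms overlap_iff by (cases z) (auto simp: slit_img_def)
  define w where "w = chart_inv (ind c) z"
  have w: "w \<in> chart_dom (ind c)" "chart_map (ind c) w = z" "fst w = chart_inv c (fst z)"
    unfolding w_def using ind_inv[OF assms(1) z] .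
  have d: "fst w \<in> chart_dom d" unfolding w using overlap_iff[OF assms(1)] assms(3) by simp
  then show "chart_inv (ind c) z \<in> chart_dom (ind d)" using w(1) unfolding w_def[symmetric] by (simp add: ind_dom)
  have z1: "fst z = chart_map c (fst w)" "snd z = snd w c" using w(2) by (auto simp: ind_map)
  have "snd w d = jacobian c d (fst z) (snd z)"
    unfolding z1 using w(1) d assms(1,2) by (intro tangent_at_jacobian) (auto simp: ind_dom TM_tangent)
  then show "transition (ind c) (ind d) z = (transition c d (fst z), jacobian c d (fst z) (snd z))"
    by (simp add: transition_def w_def[symmetric] ind_map w(3))
qed

lemma ind_transition_has_derivative:
  assumes "c \<in> A" "d \<in> A" "x \<in> overlap c d" "y \<noteq> 0"
  shows "(transition (ind c) (ind d) has_derivative (\<lambda>h. (jacobian c d x (fst h),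
     frechet_derivative (\<lambda>u. jacobian c d u y) (at x) (fst h) + jacobian c d x (snd h)))) (at (x, y))"
proof (rule has_derivative_transform_within_open[of _ _ _ _ "overlap c d \<times> (- {0})"])
  show "((\<lambda>z. (transition c d (fst z), jacobian c d (fst z) (snd z))) has_derivative (\<lambda>h. (jacobian c d x (fst h),
     frechet_derivative (\<lambda>u. jacobian c d u y) (at x) (fst h) + jacobian c d x (snd h)))) (at (x, y))"
    unfolding jacobian_def
    by (rule tangent_map_has_derivative[OF open_overlap[OF assms(1,2)] assms(3) transition_smooth[OF assms(1,2)]])
  show "open (overlap c d \<times> (- {0 :: real^'n}))" by (intro open_Times open_overlap assms) auto
  show "(transition c d (fst z), jacobian c d (fst z) (snd z)) = transition (ind c) (ind d) z"
    if "z \<in> overlap c d \<times> (- {0})" for z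
  proof -
    have "fst z \<in> overlap c d" "snd z \<noteq> 0" using that by auto
    then show ?thesis by (simp add: ind_transition(1)[OF assms(1,2)])
  qed
qed (use assms in auto)

lemma
  assumes "volume_form A \<sigma>"
  shows volume_form_smooth: "\<And>c. c \<in> A \<Longrightarrow> Ck_on k (chart_img c) (\<sigma> c)"
    and volume_form_pos: "\<And>c x. c \<in> A \<Longrightarrow> x \<in> chart_img c \<Longrightarrow> \<sigma> c x > 0"
    and volume_form_change: "\<And>c d x. c \<in> A \<Longrightarrow> d \<in> A \<Longrightarrow> x \<in> overlap c d \<Longrightarrow>
      \<sigma> c x = \<sigma> d (transition c d x) * \<bar>det (matrix (jacobian c d x))\<bar>"
  using assms unfolding volume_form_def smooth_on_def overlap_def jacobian_def by blast+

lemma overlap_transition: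
  assumes "c \<in> A" "d \<in> A" "x \<in> overlap c d"
  shows "x \<in> chart_img c" "transition c d x \<in> chart_img d"
  using assms overlap_iff[OF assms(1), of x d] by (auto simp: transition_def)

end

section \<open>Sprays on a manifold\<close>

locale spray_manifold = smooth_manifold A
  for A :: "('m::{t2_space,second_countable_topology}, real^'n) chart set" +
  fixes G :: "('m, real^'n) slit_field"
  assumes spray: "spray A G"
begin

abbreviation "Gcoeff \<equiv> spray_coeff A G"

lemma smooth_field: "smooth_vector_field (slit_atlas A) G"
  using spray unfolding spray_def by blast

lemma spray_ind:
  assumes "c \<in> A" "z \<in> slit_img c"
  shows "G (chart_inv (ind c) z) (ind c) = (snd z, - 2 *\<^sub>R Gcoeff c z)"
proof -
  have "fst z \<in> chart_img c" "snd z \<noteq> 0" using assms(2) by (auto simp: slit_img_def)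
  then have "G (chart_inv (ind c) (fst z, snd z)) (ind c) = (snd z, - 2 *\<^sub>R Gcoeff c (fst z, snd z))"
    using spray assms(1) unfolding spray_def by blast
  then show ?thesis by simp
qed

lemma spray_ind_map:
  "c \<in> A \<Longrightarrow> w \<in> chart_dom (ind c) \<Longrightarrow>
    G w (ind c) = (snd w c, - 2 *\<^sub>R Gcoeff c (chart_map (ind c) w))"
  using spray_ind[OF _ ind_map_slit_img, of c w] by (simp add: ind_inv_map) (simp add: ind_map)

lemma coeff_homogeneous:
  "c \<in> A \<Longrightarrow> x \<in> chart_img c \<Longrightarrow> y \<noteq> 0 \<Longrightarrow> r > 0 \<Longrightarrow> Gcoeff c (x, r *\<^sub>R y) = r\<^sup>2 *\<^sub>R Gcoeff c (x, y)"
  using spray unfolding spray_def by blast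

lemma field_Ck: assumes "c \<in> A" shows "Ck_on k (slit_img c) (\<lambda>z. G (chart_inv (ind c) z) (ind c))"
proof -
  have "ind c \<in> slit_atlas A" using assms by (simp add: slit_atlas_def)
  then have "smooth_on (chart_img (ind c)) (\<lambda>z. G (chart_inv (ind c) z) (ind c))"
    using smooth_field unfolding smooth_vector_field_def by blast
  then show ?thesis unfolding smooth_on_def ind_img[OF assms] by blast
qed

lemma coeff_Ck: assumes "c \<in> A" shows "Ck_on k (slit_img c) (Gcoeff c)"
proof -
  have "bounded_linear (\<lambda>v :: (real^'n) \<times> (real^'n). - (1/2) *\<^sub>R snd v)"
    by (rule bounded_linear_compose[OF bounded_linear_scaleR_right bounded_linear_snd])
  from Ck_on_compose_linear[OF open_slit_img[OF assms] this field_Ck[OF assms]]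
  show ?thesis unfolding spray_coeff_def[abs_def] .
qed

text \<open>The transformation law of the second components of \<open>G\<close>, read off from the derivative of the
  tangent map of the transition.\<close>

lemma coeff_change:
  assumes "c \<in> A" "d \<in> A" "x \<in> overlap c d" "y \<noteq> 0"
  shows "Gcoeff d (transition c d x, jacobian c d x y) = jacobian c d x (Gcoeff c (x, y))
    - (1/2) *\<^sub>R frechet_derivative (\<lambda>u. jacobian c d u y) (at x) y"
proof -
  define w where "w = chart_inv (ind c) (x, y)"
  have z: "(x, y) \<in> slit_img c" using assms overlap_transition(1) by (simp add: slit_img_def)
  have w: "w \<in> chart_dom (ind c)" "w \<in> chart_dom (ind d)" "chart_map (ind c) w = (x, y)"
    unfolding w_def using ind_inv[OF assms(1) z] ind_transition(2)[OF assms(1,2), of "(x, y)"] assms(3,4) by simp_all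
  have dw: "chart_map (ind d) w = (transition c d x, jacobian c d x y)"
    using ind_transition(1)[OF assms(1,2), of "(x, y)"] assms(3,4) unfolding w_def by (simp add: transition_def)
  have ind: "ind c \<in> slit_atlas A" "ind d \<in> slit_atlas A" using assms by (simp_all add: slit_atlas_def)
  then have "tangent_at (slit_atlas A) w (G w)"
    using smooth_field w(1) unfolding smooth_vector_field_def by blast
  from tangent_at_components[OF this ind w(1,2)]
  have "G w (ind d) = frechet_derivative (transition (ind c) (ind d)) (at (x, y)) (G w (ind c))"
    unfolding w(3) .
  also have "G w (ind c) = (y, - 2 *\<^sub>R Gcoeff c (x, y))"
    using spray_ind[OF assms(1) z] unfolding w_def by simp
  also have "frechet_derivative (transition (ind c) (ind d)) (at (x, y)) (y, - 2 *\<^sub>R Gcoeff c (x, y)) =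
     (jacobian c d x y, frechet_derivative (\<lambda>u. jacobian c d u y) (at x) y + jacobian c d x (- 2 *\<^sub>R Gcoeff c (x, y)))"
    by (simp add: frechet_derivative_eqI[OF ind_transition_has_derivative[OF assms]])
  also have "G w (ind d) = (snd w d, - 2 *\<^sub>R Gcoeff d (transition c d x, jacobian c d x y))"
    using spray_ind_map[OF assms(2) w(2)] unfolding dw .
  finally have "- 2 *\<^sub>R Gcoeff d (transition c d x, jacobian c d x y) =
    frechet_derivative (\<lambda>u. jacobian c d u y) (at x) y + jacobian c d x (- 2 *\<^sub>R Gcoeff c (x, y))" by simp
  also have "jacobian c d x (- 2 *\<^sub>R Gcoeff c (x, y)) = - 2 *\<^sub>R jacobian c d x (Gcoeff c (x, y))"
    by (rule linear_cmul[OF linear_jacobian[OF assms(1-3)]])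
  finally have "(- 1/2) *\<^sub>R (- 2 *\<^sub>R Gcoeff d (transition c d x, jacobian c d x y)) =
    (- 1/2) *\<^sub>R (frechet_derivative (\<lambda>u. jacobian c d u y) (at x) y + - 2 *\<^sub>R jacobian c d x (Gcoeff c (x, y)))"
    by (rule arg_cong)
  then show ?thesis by (simp add: scaleR_add_right scaleR_diff_right)
qed

lemma S_coord_chart_independent:
  assumes \<sigma>: "volume_form A \<sigma>" and A: "c \<in> A" "d \<in> A"
    and w: "w \<in> chart_dom (ind c)" "w \<in> chart_dom (ind d)"
  shows "S_coord (Gcoeff c) (\<sigma> c) (chart_map (ind c) w) = S_coord (Gcoeff d) (\<sigma> d) (chart_map (ind d) w)"
proof -
  define x y where "x = chart_map c (fst w)" and "y = snd w c"
  have p: "fst w \<in> chart_dom c" "fst w \<in> chart_dom d" "w \<in> TM" using w by (auto simp: ind_dom)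
  have x: "x \<in> overlap c d" unfolding x_def using p by (intro overlapI)
  have y: "y \<noteq> 0" unfolding y_def using TM_component_nonzero[OF p(3) A(1) p(1)] .
  have cw: "chart_map (ind c) w = (x, y)" by (simp add: ind_map x_def y_def)
  have dw: "chart_map (ind d) w = (transition c d x, jacobian c d x y)"
    using ind_transition(1)[OF A, of "(x, y)"] x y ind_inv_map[OF A(1) w(1)] unfolding cw by (simp add: transition_def)
  have diff: "Gcoeff e differentiable (at z)" if "e \<in> A" "z \<in> slit_img e" for e z
    using coeff_Ck[OF that(1), of "Suc 0"] that(2) by simp
  have "S_coord (Gcoeff c) (\<sigma> c) (x, y) =
     S_coord (Gcoeff d) (\<sigma> d) (transition c d x, frechet_derivative (transition c d) (at x) y)"
  proof (rule S_coord_change[OF open_overlap[OF A] x transition_smooth[OF A] y])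
    show "Gcoeff c differentiable (at (x, y))"
      using diff[OF A(1) ind_map_slit_img[OF A(1) w(1)]] unfolding cw .
    show "Gcoeff d differentiable (at (transition c d x, frechet_derivative (transition c d) (at x) y))"
      using diff[OF A(2) ind_map_slit_img[OF A(2) w(2)]] unfolding dw jacobian_def .
    show "Gcoeff d (transition c d x, frechet_derivative (transition c d) (at x) v) =
       frechet_derivative (transition c d) (at x) (Gcoeff c (x, v)) - (1 / 2) *\<^sub>R
       frechet_derivative (\<lambda>u. frechet_derivative (transition c d) (at u) v) (at x) v" if "v \<noteq> 0" for v
      using coeff_change[OF A x that] unfolding jacobian_def .
    show "\<sigma> c u > 0" if "u \<in> overlap c d" for u
      using volume_form_pos[OF \<sigma> A(1)] overlap_transition(1)[OF A that] .
    show "\<sigma> d (transition c d x) > 0"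
      using volume_form_pos[OF \<sigma> A(2)] overlap_transition(2)[OF A x] .
    show "\<sigma> d differentiable (at (transition c d x))"
      by (rule Ck_on_differentiable[OF volume_form_smooth[OF \<sigma> A(2)] order_refl overlap_transition(2)[OF A x]])
    show "\<sigma> c u = \<sigma> d (transition c d u) * \<bar>det (matrix (frechet_derivative (transition c d) (at u)))\<bar>"
      if "u \<in> overlap c d" for u
      using volume_form_change[OF \<sigma> A that] unfolding jacobian_def .
  qed
  then show ?thesis unfolding cw dw jacobian_def .
qed

lemma S_curvature_eq:
  assumes \<sigma>: "volume_form A \<sigma>" and "c \<in> A" "w \<in> chart_dom (ind c)"
  shows "S_curvature A G \<sigma> w = S_coord (Gcoeff c) (\<sigma> c) (chart_map (ind c) w)"
proof -
  let ?d = "chart_at A (fst w)"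
  have "w \<in> chart_dom (ind ?d)" using assms(3) chart_at(2) by (simp add: ind_dom)
  then have "S_coord (Gcoeff ?d) (\<sigma> ?d) (chart_map (ind ?d) w) = S_coord (Gcoeff c) (\<sigma> c) (chart_map (ind c) w)"
    using S_coord_chart_independent[OF \<sigma> chart_at(1) assms(2) _ assms(3)] by blast
  then show ?thesis by (simp add: S_curvature_def Let_def S_coord_def)
qed

text \<open>An integral curve through \<open>w\<close> for short times comes from a chart.  Completeness provides a
  global integral curve that has the same projection to the manifold for short times.  Its value at
  \<open>0\<close> is again \<open>w\<close>, because the second component of an integral curve of a spray is the velocity
  of the projection.\<close>

lemma integral_curve_exists:
  assumes complete: "complete_spray A G" and w: "w \<in> TM"
  obtains u where "integral_curve (slit_atlas A) G UNIV u" "u 0 = w"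
proof -
  obtain c where c: "c \<in> A" "fst w \<in> chart_dom c" using ex_chart by blast
  have wc: "w \<in> chart_dom (ind c)" using c w by (simp add: ind_dom)
  define F where "F = (\<lambda>z. G (chart_inv (ind c) z) (ind c))"
  obtain a v where a: "a > 0" and v0: "v 0 = chart_map (ind c) w"
    and v: "\<And>t. -a < t \<Longrightarrow> t < a \<Longrightarrow> v t \<in> slit_img c \<and> (v has_vector_derivative F (v t)) (at t)"
    using local_solution_exists[OF open_slit_img[OF c(1)] ind_map_slit_img[OF c(1) wc], of F]
      field_Ck[OF c(1), of 1] unfolding F_def by blast
  define I where "I = {-a<..<a}"
  define u where "u = (\<lambda>t. chart_inv (ind c) (v t))"
  have v': "v t \<in> slit_img c" "(v has_vector_derivative F (v t)) (at t)" if "t \<in> I" for t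
    using v that by (auto simp: I_def)
  have u0: "u 0 = w" by (simp add: u_def v0 ind_inv_map[OF c(1) wc])
  have uc: "u t \<in> chart_dom (ind c)" "chart_map (ind c) (u t) = v t" if "t \<in> I" for t
    unfolding u_def using ind_inv[OF c(1) v'(1)[OF that]] by blast+
  have curve: "integral_curve (slit_atlas A) G I u"
    unfolding integral_curve_def
  proof (intro ballI conjI impI)
    fix t assume t: "t \<in> I"
    show "u t \<in> (\<Union>c\<in>slit_atlas A. chart_dom c)" using uc[OF t] c(1) by (auto simp: slit_atlas_def)
    fix C assume C: "C \<in> slit_atlas A" "u t \<in> chart_dom C"
    then obtain d where d: "d \<in> A" "C = ind d" by (auto simp: slit_atlas_def)
    have td: "fst (v t) \<in> overlap c d" "snd (v t) \<noteq> 0"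
      using C(2) uc[OF t] v'(1)[OF t] fst_ind_inv[OF c(1) v'(1)[OF t]] overlap_iff[OF c(1)]
      unfolding d by (auto simp: ind_dom u_def slit_img_def)
    have "continuous (at t) v" using v'(2)[OF t] has_vector_derivative_continuous by blast
    then have "isCont (\<lambda>s. fst (v s)) t" by (intro continuous_fst)
    then have "\<forall>\<^sub>F s in at t. fst (v s) \<in> overlap c d"
      using topological_tendstoD open_overlap[OF c(1) d(1)] td(1) by (auto simp: isCont_def)
    moreover have evI: "\<forall>\<^sub>F s in at t. s \<in> I"
      using t unfolding I_def by (intro eventually_at_in_open') auto
    ultimately show "\<forall>\<^sub>F s in at t. u s \<in> chart_dom C"
    proof eventually_elim
      case (elim s)
      then show ?case
        using ind_transition(2)[OF c(1) d(1), of "v s"] v'(1)[of s]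
        unfolding u_def d by (simp add: slit_img_iff)
    qed
    have "(transition (ind c) (ind d) has_derivative frechet_derivative (transition (ind c) (ind d)) (at (v t))) (at (v t))"
      using ind_transition_has_derivative[OF c(1) d(1) td, unfolded prod.collapse]
      unfolding frechet_derivative_works[symmetric] differentiable_def by blast
    note D = this
    from has_derivative_compose[OF v'(2)[OF t, unfolded has_vector_derivative_def] this]
    have der: "((\<lambda>s. transition (ind c) (ind d) (v s)) has_derivative
        (\<lambda>h. frechet_derivative (transition (ind c) (ind d)) (at (v t)) (h *\<^sub>R F (v t)))) (at t)" .
    have lin: "linear (frechet_derivative (transition (ind c) (ind d)) (at (v t)))"
      by (rule has_derivative_linear[OF D])
    have "tangent_at (slit_atlas A) (u t) (G (u t))"
      using smooth_field C unfolding smooth_vector_field_def by blast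
    then have "G (u t) C = frechet_derivative (transition (ind c) C) (at (chart_map (ind c) (u t))) (G (u t) (ind c))"
      by (rule tangent_at_components) (use C uc[OF t] c(1) in \<open>simp_all add: slit_atlas_def\<close>)
    from this[unfolded uc(2)[OF t]] have GC: "G (u t) C = frechet_derivative (transition (ind c) (ind d)) (at (v t)) (F (v t))"
      unfolding d F_def u_def .
    have "((\<lambda>s. transition (ind c) (ind d) (v s)) has_vector_derivative G (u t) C) (at t)"
      using der unfolding has_vector_derivative_def GC linear_cmul[OF lin] .
    then show "((chart_map C \<circ> u) has_vector_derivative G (u t) C) (at t)"
      by (simp add: o_def transition_def u_def d)
  qed
  have I: "open I" "is_interval I" "0 \<in> I" using a by (auto simp: I_def is_interval_oo)
  have "geodesic A G I (\<lambda>t. fst (u t))" unfolding geodesic_def using curve by blast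
  then obtain \<delta> where "geodesic A G UNIV \<delta>" and \<delta>: "\<And>t. t \<in> I \<Longrightarrow> \<delta> t = fst (u t)"
    using complete I unfolding complete_spray_def by blast
  then obtain u' where u': "integral_curve (slit_atlas A) G UNIV u'" "\<And>t. \<delta> t = fst (u' t)"
    unfolding geodesic_def by blast
  have base: "fst (u' t) = fst (u t)" if "t \<in> I" for t using \<delta>[OF that] u'(2) by simp
  show ?thesis
  proof (rule that[OF u'(1)])
    have "u' 0 \<in> TM"
      using u'(1) unfolding integral_curve_def by (fastforce simp: slit_atlas_def ind_dom)
    then have u'c: "u' 0 \<in> chart_dom (ind c)" using base[OF I(3)] uc(1)[OF I(3)] by (simp add: ind_dom)
    have "((chart_map (ind c) \<circ> u') has_vector_derivative G (u' 0) (ind c)) (at 0)"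
      "((chart_map (ind c) \<circ> u) has_vector_derivative G (u 0) (ind c)) (at 0)"
      using u'(1) curve u'c uc(1)[OF I(3)] c(1) I(3) unfolding integral_curve_def by (auto simp: slit_atlas_def)
    from this[THEN bounded_linear.has_vector_derivative[OF bounded_linear_fst]]
    have d1: "((\<lambda>t. chart_map c (fst (u' t))) has_vector_derivative snd (u' 0) c) (at 0)"
      and d2: "((\<lambda>t. chart_map c (fst (u t))) has_vector_derivative snd (u 0) c) (at 0)"
      using spray_ind_map[OF c(1) u'c] spray_ind_map[OF c(1) uc(1)[OF I(3)]] by (simp_all add: o_def ind_map)
    have "((\<lambda>t. chart_map c (fst (u t))) has_vector_derivative snd (u' 0) c) (at 0)"
      by (rule has_vector_derivative_transform_within_open[OF d1 I(1,3)]) (simp add: base)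
    from vector_derivative_unique_at[OF this d2] have "snd (u' 0) c = snd (u 0) c" .
    then have "snd (u' 0) = snd (u 0)"
      using TM_tangent[OF \<open>u' 0 \<in> TM\<close>] TM_tangent[OF w] c base[OF I(3)] u0
      by (intro tangent_at_eqI[of "fst w" _ _ c]) simp_all
    then show "u' 0 = w" using base[OF I(3)] u0 by (simp add: prod_eq_iff)
  qed
qed

text \<open>The function \<open>P\<close> for which \<open>G\<^sup>i - P y\<^sup>i\<close> are the coefficients of the projective spray.\<close>

definition projective_factor :: "('m, 'n) density \<Rightarrow> ('m, real^'n) chart \<Rightarrow> (real^'n) \<times> (real^'n) \<Rightarrow> real" where
  "projective_factor \<sigma> c z = S_coord (Gcoeff c) (\<sigma> c) z / (real CARD('n) + 1)"

lemma projective_spray_coeff: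
  assumes \<sigma>: "volume_form A \<sigma>" and c: "c \<in> A" and z: "z \<in> slit_img c"
  shows "spray_coeff A (projective_spray A G \<sigma>) c z = Gcoeff c z - projective_factor \<sigma> c z *\<^sub>R snd z"
proof -
  define w where "w = chart_inv (ind c) z"
  have w: "w \<in> chart_dom (ind c)" "chart_map (ind c) w = z"
    unfolding w_def using ind_inv[OF c z] by blast+
  have "ind c \<in> slit_atlas A" using c by (simp add: slit_atlas_def)
  then have "projective_spray A G \<sigma> w (ind c) = (snd z, - 2 *\<^sub>R Gcoeff c z) + (2 * projective_factor \<sigma> c z) *\<^sub>R (0, snd z)"
    unfolding projective_spray_def liouville_field_def S_curvature_eq[OF \<sigma> c w(1)] projective_factor_def w(2)
    using w(1) spray_ind[OF c z] by (simp add: w_def)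
  then have "spray_coeff A (projective_spray A G \<sigma>) c z =
     - (1/2) *\<^sub>R (- 2 *\<^sub>R Gcoeff c z + (2 * projective_factor \<sigma> c z) *\<^sub>R snd z)"
    by (simp add: spray_coeff_def w_def)
  then show ?thesis by (simp add: scaleR_add_right scaleR_diff_right)
qed

lemma projective_ricci_eq:
  fixes w :: "('m, real^'n) tvec"
  assumes \<sigma>: "volume_form A \<sigma>" and w: "w \<in> TM"
  defines "c \<equiv> chart_at A (fst w)"
  shows "projective_ricci A G \<sigma> w = ricci A G w + (real CARD('n) - 1) *
    (frechet_derivative (projective_factor \<sigma> c) (at (chart_map (ind c) w)) (G w (ind c))
      + (projective_factor \<sigma> c (chart_map (ind c) w))\<^sup>2)"
proof -
  have c: "c \<in> A" and wc: "w \<in> chart_dom (ind c)" using chart_at w by (simp_all add: c_def ind_dom)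
  define z where "z = chart_map (ind c) w"
  have z: "z \<in> slit_img c" unfolding z_def by (rule ind_map_slit_img[OF c wc])
  have "projective_ricci A G \<sigma> w = ricci_coord (spray_coeff A (projective_spray A G \<sigma>) c) z"
    by (simp add: projective_ricci_def ricci_def Let_def c_def z_def)
  also have "\<dots> = ricci_coord (\<lambda>u. Gcoeff c u - projective_factor \<sigma> c u *\<^sub>R snd u) z"
    by (rule ricci_coord_cong[OF open_slit_img[OF c] z projective_spray_coeff[OF \<sigma> c]])
  also have "\<dots> = ricci_coord (Gcoeff c) z + (real CARD('n) - 1) *
    (frechet_derivative (projective_factor \<sigma> c) (at z) (snd z, - 2 *\<^sub>R Gcoeff c z) + (projective_factor \<sigma> c z)\<^sup>2)"
    unfolding projective_factor_def[abs_def]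
  proof (rule ricci_coord_projective_spray[OF open_chart_img[OF c]])
    show "Ck_on 3 (chart_img c \<times> - {0}) (Gcoeff c)" using coeff_Ck[OF c] unfolding slit_img_def .
  qed (use z coeff_homogeneous[OF c] volume_form_smooth[OF \<sigma> c] volume_form_pos[OF \<sigma> c] in \<open>auto simp: slit_img_def\<close>)
  also have "(snd z, - 2 *\<^sub>R Gcoeff c z) = G w (ind c)"
    unfolding spray_ind_map[OF c wc] z_def by (simp add: ind_map)
  also have "ricci_coord (Gcoeff c) z = ricci A G w"
    by (simp add: ricci_def Let_def c_def z_def)
  finally show ?thesis unfolding z_def .
qed

lemma projective_factor_Ck:
  assumes \<sigma>: "volume_form A \<sigma>" and c: "c \<in> A" shows "Ck_on k (slit_img c) (projective_factor \<sigma> c)"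
proof -
  have "Ck_on k (chart_img c \<times> - {0}) (S_coord (Gcoeff c) (\<sigma> c))"
    by (rule Ck_on_S_coord[OF open_chart_img[OF c] coeff_Ck[OF c, unfolded slit_img_def]
          volume_form_smooth[OF \<sigma> c] volume_form_pos[OF \<sigma> c]])
  from Ck_on_cmult[OF open_slit_img[OF c, unfolded slit_img_def] this, of "inverse (real CARD('n) + 1)"]
  show ?thesis unfolding projective_factor_def[abs_def] slit_img_def by (simp add: divide_inverse mult.commute)
qed

lemma S_curvature_along_integral_curve:
  assumes \<sigma>: "volume_form A \<sigma>" and u: "integral_curve (slit_atlas A) G UNIV u"
  defines "c \<equiv> \<lambda>t. chart_at A (fst (u t))"
  shows "((\<lambda>t. S_curvature A G \<sigma> (u t) / (real CARD('n) + 1)) has_real_derivative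
    frechet_derivative (projective_factor \<sigma> (c t)) (at (chart_map (ind (c t)) (u t))) (G (u t) (ind (c t)))) (at t)"
proof -
  have TM: "u t \<in> TM" using u unfolding integral_curve_def by (fastforce simp: slit_atlas_def ind_dom)
  define d where "d = c t"
  have d: "d \<in> A" "u t \<in> chart_dom (ind d)" using chart_at TM by (simp_all add: d_def c_def ind_dom)
  have C: "ind d \<in> slit_atlas A" using d by (simp add: slit_atlas_def)
  have ev: "\<forall>\<^sub>F s in at t. u s \<in> chart_dom (ind d)"
    and der: "((chart_map (ind d) \<circ> u) has_vector_derivative G (u t) (ind d)) (at t)"
    using u C d(2) unfolding integral_curve_def by blast+
  let ?z = "chart_map (ind d) (u t)"
  have "projective_factor \<sigma> d differentiable (at ?z)"
    by (rule Ck_on_differentiable[OF projective_factor_Ck[OF \<sigma> d(1)] order_refl ind_map_slit_img[OF d]])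
  then have D: "(projective_factor \<sigma> d has_derivative frechet_derivative (projective_factor \<sigma> d) (at ?z)) (at ((chart_map (ind d) \<circ> u) t))"
    by (simp add: frechet_derivative_works[symmetric])
  have lin: "linear (frechet_derivative (projective_factor \<sigma> d) (at ?z))" by (rule has_derivative_linear[OF D])
  from has_derivative_compose[OF der[unfolded has_vector_derivative_def] D]
  have "((\<lambda>s. projective_factor \<sigma> d ((chart_map (ind d) \<circ> u) s)) has_derivative
     (\<lambda>h. frechet_derivative (projective_factor \<sigma> d) (at ?z) (h *\<^sub>R G (u t) (ind d)))) (at t)" .
  moreover have "(\<lambda>h. frechet_derivative (projective_factor \<sigma> d) (at ?z) (h *\<^sub>R G (u t) (ind d)))
     = (*) (frechet_derivative (projective_factor \<sigma> d) (at ?z) (G (u t) (ind d)))"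
    unfolding linear_cmul[OF lin] by (simp add: fun_eq_iff mult.commute)
  ultimately have P': "((\<lambda>s. projective_factor \<sigma> d ((chart_map (ind d) \<circ> u) s)) has_derivative
     (*) (frechet_derivative (projective_factor \<sigma> d) (at ?z) (G (u t) (ind d)))) (at t)"
    by (simp only:)
  have eq: "projective_factor \<sigma> d ((chart_map (ind d) \<circ> u) s) = S_curvature A G \<sigma> (u s) / (real CARD('n) + 1)"
    if "u s \<in> chart_dom (ind d)" for s
    using S_curvature_eq[OF \<sigma> d(1) that] by (simp add: projective_factor_def)
  from P' have "((\<lambda>s. S_curvature A G \<sigma> (u s) / (real CARD('n) + 1)) has_derivative
     (*) (frechet_derivative (projective_factor \<sigma> d) (at ?z) (G (u t) (ind d)))) (at t)"
    by (rule has_derivative_transform_eventually) (use ev eq d(2) in \<open>auto elim: eventually_mono\<close>)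
  then show ?thesis unfolding has_field_derivative_def d_def .
qed

context
  fixes \<sigma> :: "('m, 'n) density"
  assumes \<sigma>: "volume_form A \<sigma>" and dim: "2 \<le> CARD('n)"
    and complete: "complete_spray A G"
    and flat: "\<And>w. w \<in> TM \<Longrightarrow> projective_ricci A G \<sigma> w = 0"
    and nonneg: "\<And>w. w \<in> TM \<Longrightarrow> 0 \<le> ricci A G w"
begin

text \<open>The function \<open>P\<close> satisfies the Riccati inequality along a complete integral curve.\<close>

lemma S_curvature_zero:
  assumes w: "w \<in> TM" shows "S_curvature A G \<sigma> w = 0"
proof -
  obtain u where u: "integral_curve (slit_atlas A) G UNIV u" "u 0 = w"
    using integral_curve_exists[OF complete w] .
  define f where "f = (\<lambda>t. S_curvature A G \<sigma> (u t) / (real CARD('n) + 1))"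
  define c where "c t = chart_at A (fst (u t))" for t
  define D where "D t = frechet_derivative (projective_factor \<sigma> (c t)) (at (chart_map (ind (c t)) (u t))) (G (u t) (ind (c t)))" for t
  have TM: "u t \<in> TM" for t using u(1) unfolding integral_curve_def by (fastforce simp: slit_atlas_def ind_dom)
  have "(f has_real_derivative D t) (at t)" for t
    unfolding f_def D_def c_def by (rule S_curvature_along_integral_curve[OF \<sigma> u(1)])
  moreover have "D t \<le> - (f t)\<^sup>2" for t
  proof -
    have "c t \<in> A" "u t \<in> chart_dom (ind (c t))" using chart_at TM by (simp_all add: c_def ind_dom)
    then have f: "projective_factor \<sigma> (c t) (chart_map (ind (c t)) (u t)) = f t"
      using S_curvature_eq[OF \<sigma>] by (simp add: projective_factor_def f_def)
    have "(real CARD('n) - 1) * (D t + (f t)\<^sup>2) \<le> 0"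
      using projective_ricci_eq[OF \<sigma> TM, of t] flat[OF TM, of t] nonneg[OF TM, of t]
      unfolding c_def[symmetric] D_def[symmetric] f by linarith
    then show ?thesis using dim by (simp add: mult_le_0_iff)
  qed
  ultimately have "f 0 = 0" by (rule riccati_global_solution_zero)
  then show ?thesis by (simp add: f_def u(2))
qed

text \<open>Since \<open>P\<close> vanishes identically, so does its derivative along the spray, and the Ricci curvature
  coincides with the projective Ricci curvature.\<close>

lemma ricci_zero:
  assumes w: "w \<in> TM" shows "ricci A G w = 0"
proof -
  define c where "c = chart_at A (fst w)"
  have c: "c \<in> A" and wc: "w \<in> chart_dom (ind c)" using chart_at w by (simp_all add: c_def ind_dom)
  have P: "projective_factor \<sigma> c z = 0" if "z \<in> slit_img c" for z
  proof -
    have d: "chart_inv (ind c) z \<in> chart_dom (ind c)" and m: "chart_map (ind c) (chart_inv (ind c) z) = z"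
      using ind_inv[OF c that] by blast+
    have "S_curvature A G \<sigma> (chart_inv (ind c) z) = 0" using S_curvature_zero d by (simp add: ind_dom)
    then show ?thesis unfolding S_curvature_eq[OF \<sigma> c d] m by (simp add: projective_factor_def)
  qed
  have z: "chart_map (ind c) w \<in> slit_img c" by (rule ind_map_slit_img[OF c wc])
  have "frechet_derivative (projective_factor \<sigma> c) (at (chart_map (ind c) w)) =
      frechet_derivative (\<lambda>_. 0) (at (chart_map (ind c) w))"
    by (rule frechet_derivative_cong_open[OF open_slit_img[OF c] z P])
  then show ?thesis
    using projective_ricci_eq[OF \<sigma> w] flat[OF w] P[OF z] by (simp add: c_def)
qed

end

end

section \<open>Change of the volume form\<close>

context smooth_manifold
begin

lemma log_ratio_chart_independent:
  assumes \<sigma>: "volume_form A \<sigma>" and \<mu>: "volume_form A \<mu>" and A: "c \<in> A" "d \<in> A" and x: "x \<in> overlap c d"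
  shows "ln (\<sigma> c x) - ln (\<mu> c x) = ln (\<sigma> d (transition c d x)) - ln (\<mu> d (transition c d x))"
proof -
  let ?J = "\<bar>det (matrix (jacobian c d x))\<bar>"
  have "\<sigma> c x > 0" "\<sigma> d (transition c d x) > 0" "\<mu> d (transition c d x) > 0"
    using volume_form_pos[OF \<sigma>] volume_form_pos[OF \<mu>] overlap_transition[OF A x] A by auto
  moreover from this have "?J > 0" using volume_form_change[OF \<sigma> A x] by (simp add: zero_less_mult_iff)
  ultimately show ?thesis
    unfolding volume_form_change[OF \<sigma> A x] volume_form_change[OF \<mu> A x] by (simp add: ln_mult_pos)
qed

definition log_ratio :: "('m, 'n) density \<Rightarrow> ('m, 'n) density \<Rightarrow> 'm \<Rightarrow> real" where
  "log_ratio \<sigma> \<mu> p = (let c = chart_at A p in ln (\<sigma> c (chart_map c p)) - ln (\<mu> c (chart_map c p)))"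

lemma log_ratio_chart:
  assumes "volume_form A \<sigma>" "volume_form A \<mu>" "c \<in> A" "x \<in> chart_img c"
  shows "log_ratio \<sigma> \<mu> (chart_inv c x) = ln (\<sigma> c x) - ln (\<mu> c x)"
proof -
  let ?d = "chart_at A (chart_inv c x)"
  have "x \<in> overlap c ?d" using overlap_iff[OF assms(3)] assms(4) chart_at(2) by blast
  from log_ratio_chart_independent[OF assms(1-3) chart_at(1) this] show ?thesis
    by (simp add: log_ratio_def Let_def transition_def)
qed

lemma log_ratio_Ck:
  assumes "volume_form A \<sigma>" "volume_form A \<mu>" "c \<in> A"
  shows "Ck_on k (chart_img c) (\<lambda>x. ln (\<sigma> c x) - ln (\<mu> c x))"
  using assms by (intro Ck_on_diff Ck_on_ln open_chart_img volume_form_smooth volume_form_pos)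

lemma scalar_function_log_ratio:
  assumes "volume_form A \<sigma>" "volume_form A \<mu>"
  shows "scalar_function A (\<lambda>p. r * log_ratio \<sigma> \<mu> p)"
  unfolding scalar_function_def smooth_on_def
proof (intro ballI allI)
  fix c k assume c: "c \<in> A"
  show "Ck_on k (chart_img c) ((\<lambda>p. r * log_ratio \<sigma> \<mu> p) \<circ> chart_inv c)"
    by (rule Ck_on_cong[OF open_chart_img[OF c] _ Ck_on_cmult[OF open_chart_img[OF c] log_ratio_Ck[OF assms c], of k r]])
       (simp add: log_ratio_chart[OF assms c])
qed

end

text \<open>Only the term with the density depends on the volume form.  The factor \<open>r\<close> is a free
  normalisation of the potential; below it is \<open>n + 1\<close>.\<close>

lemma (in spray_manifold) S_curvature_change_volume_form:
  assumes \<sigma>: "volume_form A \<sigma>" and \<mu>: "volume_form A \<mu>" and w: "w \<in> TM" and r: "r \<noteq> 0"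
  shows "S_curvature A G \<mu> w = S_curvature A G \<sigma> w + r * differential_along A (\<lambda>p. inverse r * log_ratio \<sigma> \<mu> p) w"
proof -
  define c where "c = chart_at A (fst w)"
  have c: "c \<in> A" and wc: "w \<in> chart_dom (ind c)" using chart_at w by (simp_all add: c_def ind_dom)
  define x where "x = chart_map c (fst w)"
  have x: "x \<in> chart_img c" using wc by (simp add: x_def ind_dom)
  have ln: "(\<lambda>x. ln (\<rho> c x)) differentiable (at x)" if "volume_form A \<rho>" for \<rho>
    using Ck_on_differentiable[OF Ck_on_ln[OF open_chart_img[OF c] volume_form_smooth[OF that c] volume_form_pos[OF that c]] order_refl x] .
  have "frechet_derivative ((\<lambda>p. inverse r * log_ratio \<sigma> \<mu> p) \<circ> chart_inv c) (at x) =
    frechet_derivative (\<lambda>x. inverse r * (ln (\<sigma> c x) - ln (\<mu> c x))) (at x)"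
    by (rule frechet_derivative_cong_open[OF open_chart_img[OF c] x]) (simp add: log_ratio_chart[OF \<sigma> \<mu> c])
  also have "\<dots> = (\<lambda>v. inverse r * (frechet_derivative (\<lambda>x. ln (\<sigma> c x)) (at x) v - frechet_derivative (\<lambda>x. ln (\<mu> c x)) (at x) v))"
    by (intro frechet_derivative_eqI has_derivative_mult_right has_derivative_diff
        frechet_derivative_works[THEN iffD1] ln \<sigma> \<mu>)
  finally have pd: "r * pd m ((\<lambda>p. inverse r * log_ratio \<sigma> \<mu> p) \<circ> chart_inv c) x
     = pd m (\<lambda>x. ln (\<sigma> c x)) x - pd m (\<lambda>x. ln (\<mu> c x)) x" for m
    using r by (simp add: pd_def)
  have "r * differential_along A (\<lambda>p. inverse r * log_ratio \<sigma> \<mu> p) w =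
     (\<Sum>m\<in>UNIV. (r * pd m ((\<lambda>p. inverse r * log_ratio \<sigma> \<mu> p) \<circ> chart_inv c) x) * snd w c $ m)"
    by (simp add: differential_along_def Let_def c_def[symmetric] ind_map x_def[symmetric] sum_distrib_left mult.assoc)
  then show ?thesis
    unfolding S_curvature_eq[OF \<sigma> c wc] S_curvature_eq[OF \<mu> c wc] S_coord_def pd
    by (simp add: ind_map x_def[symmetric] algebra_simps sum_subtractf)
qed

theorem theorem1p4:
  fixes A :: "('m::{t2_space,second_countable_topology}, real^'n) chart set"
    and G :: "('m, real^'n) slit_field"
  assumes manifold: "smooth_structure A"
    and dim: "2 \<le> CARD('n)"
    and spray: "spray A G"
    and complete: "complete_spray A G"
    and flat: "projectively_ricci_flat A G"
    and nonneg: "\<forall>w\<in>slit_tangent_bundle A. 0 \<le> ricci A G w"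
  shows "(\<forall>dV. volume_form A dV \<longrightarrow>
           (\<exists>\<phi>. scalar_function A \<phi> \<and>
              (\<forall>w\<in>slit_tangent_bundle A.
                 S_curvature A G dV w = (real CARD('n) + 1) * differential_along A \<phi> w)))
         \<and> (\<forall>w\<in>slit_tangent_bundle A. ricci A G w = 0)"
proof -
  interpret spray_manifold A G by unfold_locales (rule manifold, rule spray)
  obtain \<sigma> where \<sigma>: "volume_form A \<sigma>" "\<forall>w\<in>TM. projective_ricci A G \<sigma> w = 0"
    using flat unfolding projectively_ricci_flat_def by blast
  note S_zero = S_curvature_zero[OF \<sigma>(1) dim complete bspec[OF \<sigma>(2)] bspec[OF nonneg], simplified]
    and Ric_zero = ricci_zero[OF \<sigma>(1) dim complete bspec[OF \<sigma>(2)] bspec[OF nonneg], simplified]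
  let ?n = "real CARD('n) + 1"
  have n: "?n \<noteq> 0" by simp
  show ?thesis
  proof (intro conjI allI impI ballI)
    fix dV assume dV: "volume_form A dV"
    let ?\<phi> = "\<lambda>p. inverse ?n * log_ratio \<sigma> dV p"
    have "S_curvature A G dV w = ?n * differential_along A ?\<phi> w" if "w \<in> TM" for w
      using S_curvature_change_volume_form[OF \<sigma>(1) dV that n] S_zero[OF that] by simp
    with scalar_function_log_ratio[OF \<sigma>(1) dV] show "\<exists>\<phi>. scalar_function A \<phi> \<and>
        (\<forall>w\<in>TM. S_curvature A G dV w = ?n * differential_along A \<phi> w)"
      by blast
  next
    fix w assume "w \<in> TM"
    then show "ricci A G w = 0" by (rule Ric_zero)
  qed
qed

end
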